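(* Let $m\in\mathbb{N}=\{1,2,3,\dots\}$, and let $\mathscr{B}$ be a Banach algebra (with pointwise operations and norm $\|\cdot\|_{\mathscr{B}}$) such that (1) $\mathscr{P}\subset\mathscr{B}\subset\mathscr{H}^\infty$; (2) there exists $C>0$ such that $\|f\|_\infty\le C\|f\|_{\mathscr{B}}$ for all $f\in\mathscr{B}$; (3) $\mathscr{B}$ has the Wiener property: for all $f\in\mathscr{B}$ satisfying $\inf_{s\in\mathbb{C}_+}|f(s)|>0$, we have $\frac1f\in\mathscr{B}$. Then the Bass stable rank of $\partial^{-m}\mathscr{B}$ is infinite.
   Context: $\mathbb{C}_+=\{s\in\mathbb{C}:\mathrm{Re}(s)>0\}$. $\mathscr{H}^\infty$ is the set of all Dirichlet series $f(s)=\sum_{n=1}^\infty \frac{a_n}{n^s}$ ($a_n\in\mathbb{C}$) that converge at every $s\in\mathbb{C}_+$ and satisfy $\|f\|_\infty:=\sup_{s\in\mathbb{C}_+}|f(s)|<\infty$; it is a Banach algebra with pointwise operations and the norm $\|\cdot\|_\infty$. $\mathscr{P}\subset\mathscr{H}^\infty$ is the set of Dirichlet polynomials, i.e. Dirichlet series $\sum_{n=1}^N\frac{a_n}{n^s}$ with $N\in\mathbb{N}$, $a_1,\dots,a_N\in\mathbb{C}$. For $m\in\mathbb{N}$, $\partial^{-m}\mathscr{B}$ denotes the Banach algebra of all $f\in\mathscr{B}$ such that $f',\dots,f^{(m)}\in\mathscr{B}$ (derivatives with respect to $s\in\mathbb{C}_+$), with pointwise operations and the norm $\|f\|_{\partial^{-m}\mathscr{B}}=\sum_{\ell=0}^m\frac{1}{\ell!}\|f^{(\ell)}\|_{\mathscr{B}}$.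 Let $A$ be a unital commutative ring. An element $(a_1,\dots,a_n)\in A^n$ is unimodular if there exist $b_1,\dots,b_n\in A$ with $b_1a_1+\cdots+b_na_n=1$; $U_n(A)$ denotes the set of unimodular elements of $A^n$. An element $(a_1,\dots,a_{n+1})\in U_{n+1}(A)$ is reducible if there exist $x_1,\dots,x_n\in A$ such that $(a_1+x_1a_{n+1},\dots,a_n+x_na_{n+1})\in U_n(A)$. The Bass stable rank of $A$ is the least $n\in\mathbb{N}$ for which every element of $U_{n+1}(A)$ is reducible; it is infinite if there is no such $n$. *)

theory Defs
  imports "HOL-Analysis.Analysis" "HOL-Algebra.Ring" "HOL-Library.Extended_Nat"
begin

definition right_half_plane :: "complex set" where
  "right_half_plane = {s. Re s > 0}"

text \<open>
  A complex function on the right half-plane is represented by an element of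
  \<^term>\<open>extensional right_half_plane\<close>, so that equality in HOL is equality of functions on the
  half-plane.  The pointwise operations therefore restrict their results.
\<close>

definition fun_add :: "(complex \<Rightarrow> complex) \<Rightarrow> (complex \<Rightarrow> complex) \<Rightarrow> complex \<Rightarrow> complex" where
  "fun_add f g = (\<lambda>s\<in>right_half_plane. f s + g s)"

definition fun_diff :: "(complex \<Rightarrow> complex) \<Rightarrow> (complex \<Rightarrow> complex) \<Rightarrow> complex \<Rightarrow> complex" where
  "fun_diff f g = (\<lambda>s\<in>right_half_plane. f s - g s)"

definition fun_mult :: "(complex \<Rightarrow> complex) \<Rightarrow> (complex \<Rightarrow> complex) \<Rightarrow> complex \<Rightarrow> complex" where
  "fun_mult f g = (\<lambda>s\<in>right_half_plane. f s * g s)"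

definition fun_scale :: "complex \<Rightarrow> (complex \<Rightarrow> complex) \<Rightarrow> complex \<Rightarrow> complex" where
  "fun_scale c f = (\<lambda>s\<in>right_half_plane. c * f s)"

definition fun_const :: "complex \<Rightarrow> complex \<Rightarrow> complex" where
  "fun_const c = (\<lambda>s\<in>right_half_plane. c)"

definition fun_inverse :: "(complex \<Rightarrow> complex) \<Rightarrow> complex \<Rightarrow> complex" where
  "fun_inverse f = (\<lambda>s\<in>right_half_plane. 1 / f s)"

definition H_infinity :: "(complex \<Rightarrow> complex) set" where
  "H_infinity = {f \<in> extensional right_half_plane.
     (\<exists>a. \<forall>s\<in>right_half_plane. (\<lambda>n. a (Suc n) / of_nat (Suc n) powr s) sums f s) \<and>
     bounded (f ` right_half_plane)}"

definition sup_norm :: "(complex \<Rightarrow> complex) \<Rightarrow> real" where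
  "sup_norm f = (SUP s\<in>right_half_plane. norm (f s))"

definition dirichlet_polynomials :: "(complex \<Rightarrow> complex) set" where
  "dirichlet_polynomials =
     {(\<lambda>s\<in>right_half_plane. \<Sum>n=1..N. a n / of_nat n powr s) | a N. N \<ge> (1::nat)}"

text \<open>
  Complex Banach algebras of functions on the right half-plane.  The values of the norm outside
  the carrier are irrelevant.  Existence of a unit and the normalisation of its norm are not
  part of the definition.
\<close>

locale banach_function_algebra =
  fixes B :: "(complex \<Rightarrow> complex) set" and N :: "(complex \<Rightarrow> complex) \<Rightarrow> real"
  assumes subset_extensional: "B \<subseteq> extensional right_half_plane"
    and zero_closed: "fun_const 0 \<in> B"
    and add_closed: "\<And>f g. f \<in> B \<Longrightarrow> g \<in> B \<Longrightarrow> fun_add f g \<in> B"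
    and scale_closed: "\<And>c f. f \<in> B \<Longrightarrow> fun_scale c f \<in> B"
    and mult_closed: "\<And>f g. f \<in> B \<Longrightarrow> g \<in> B \<Longrightarrow> fun_mult f g \<in> B"
    and norm_nonneg: "\<And>f. f \<in> B \<Longrightarrow> 0 \<le> N f"
    and norm_eq_zero: "\<And>f. f \<in> B \<Longrightarrow> N f = 0 \<longleftrightarrow> f = fun_const 0"
    and norm_scale: "\<And>c f. f \<in> B \<Longrightarrow> N (fun_scale c f) = cmod c * N f"
    and norm_triangle: "\<And>f g. f \<in> B \<Longrightarrow> g \<in> B \<Longrightarrow> N (fun_add f g) \<le> N f + N g"
    and norm_mult: "\<And>f g. f \<in> B \<Longrightarrow> g \<in> B \<Longrightarrow> N (fun_mult f g) \<le> N f * N g"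
    and norm_complete: "\<And>F :: nat \<Rightarrow> complex \<Rightarrow> complex.
          range F \<subseteq> B \<Longrightarrow>
          (\<forall>e>0. \<exists>K. \<forall>i\<ge>K. \<forall>j\<ge>K. N (fun_diff (F i) (F j)) < e) \<Longrightarrow>
          \<exists>f\<in>B. (\<lambda>i. N (fun_diff (F i) f)) \<longlonglongrightarrow> 0"

definition wiener_property :: "(complex \<Rightarrow> complex) set \<Rightarrow> bool" where
  "wiener_property B \<longleftrightarrow>
     (\<forall>f\<in>B. (INF s\<in>right_half_plane. norm (f s)) > 0 \<longrightarrow> fun_inverse f \<in> B)"

text \<open>
  The half-plane is open, so the values of \<^term>\<open>f\<close> outside it do not affect these derivatives.
\<close>

definition fun_deriv :: "nat \<Rightarrow> (complex \<Rightarrow> complex) \<Rightarrow> complex \<Rightarrow> complex" where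
  "fun_deriv l f = (\<lambda>s\<in>right_half_plane. (deriv ^^ l) f s)"

text \<open>
  The ring underlying $\partial^{-m}B$.  Its norm is omitted because the stable rank depends only
  on the ring structure.
\<close>

definition deriv_algebra :: "nat \<Rightarrow> (complex \<Rightarrow> complex) set \<Rightarrow> (complex \<Rightarrow> complex) ring" where
  "deriv_algebra m B =
     \<lparr>carrier = {f \<in> B. \<forall>l\<in>{1..m}. fun_deriv l f \<in> B},
      mult = fun_mult, one = fun_const 1, zero = fun_const 0, add = fun_add\<rparr>"

text \<open>
  Tuples in $A^n$ are extensional functions on \<^term>\<open>{1..n}\<close>.
\<close>

definition unimodular :: "('a, 'b) ring_scheme \<Rightarrow> nat \<Rightarrow> (nat \<Rightarrow> 'a) set" where
  "unimodular A n = {a \<in> {1..n} \<rightarrow>\<^sub>E carrier A.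
     \<exists>b \<in> {1..n} \<rightarrow>\<^sub>E carrier A. (\<Oplus>\<^bsub>A\<^esub>i\<in>{1..n}. b i \<otimes>\<^bsub>A\<^esub> a i) = \<one>\<^bsub>A\<^esub>}"

definition reducible :: "('a, 'b) ring_scheme \<Rightarrow> nat \<Rightarrow> (nat \<Rightarrow> 'a) \<Rightarrow> bool" where
  "reducible A n a \<longleftrightarrow>
     (\<exists>x \<in> {1..n} \<rightarrow>\<^sub>E carrier A.
        (\<lambda>i\<in>{1..n}. a i \<oplus>\<^bsub>A\<^esub> x i \<otimes>\<^bsub>A\<^esub> a (n + 1)) \<in> unimodular A n)"

text \<open>
  The infimum in \<^typ>\<open>enat\<close> is the least element of a nonempty set, and \<^term>\<open>\<infinity> :: enat\<close> for
  the empty set.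
\<close>

definition bass_stable_rank :: "('a, 'b) ring_scheme \<Rightarrow> enat" where
  "bass_stable_rank A =
     Inf (enat ` {n. n \<ge> 1 \<and> (\<forall>a \<in> unimodular A (n + 1). reducible A n a)})"

end

(*
The coefficients of a series in H_infinity are uniquely determined and O(n^(1/2)), so every completely
multiplicative chi with |chi n| <= n^-2 yields a ring homomorphism sum a_n n^-s |-> sum a_n chi(n), which
is continuous in chi. Take 2n distinct primes p_1, q_1, ..., p_n, q_n and a small r > 0. The tuple
(p_1^-s, ..., p_n^-s, 1 - r^-2 sum_j (p_j q_j)^-s) is unimodular, with the multipliers r^-2 q_j^-s and 1.
For z in the closed unit ball of C^n let chi_z(p_j) = r z_j, chi_z(q_j) = r conj(z_j) and chi_z = 0 at the
other primes. If the tuple were reducible via x_1, ..., x_n, then applying chi_z would make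
z |-> (r z_j + chi_z(x_j) (1 - |z|^2))_j a continuous map without zeros on the ball that equals r z on
the sphere, and the sphere would be contractible.
*)
theory Submission
  imports Defs "HOL-Complex_Analysis.Complex_Analysis" "HOL-Homology.Homology"
begin

no_notation Infinite_Set_Sum.abs_summable_on (infix \<open>abs'_summable'_on\<close> 50)
notation Infinite_Sum.abs_summable_on (infixr \<open>abs'_summable'_on\<close> 46)

section \<open>Maps of the ball that are radial on the sphere\<close>

text \<open>Evaluation at points of the half-plane is a family with a single complex parameter,
  while a ball of C^n needs n independent ones. Letting the values at primes vary freely supplies
  them, at the price that a character must be read off coefficients rather than function values;
  hence uniqueness of coefficients and absolute convergence have to be settled before any character
  can be applied. Since 1 - |z|^2 is not holomorphic in z, one prime per coordinate would not do:
  the second prime carries the conjugate, and the squared modulus becomes a product of two character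
  values. Smallness of r keeps the values at the chosen primes below p^-2, and the factor r^-2
  compensates for it in the last entry. Derivatives enter through closure. Products stay in the ring
  by the Leibniz rule, for which the series must be known to be holomorphic; the entries of the
  tuple lie in it because derivatives of Dirichlet polynomials are Dirichlet polynomials.\<close>

definition finball :: "nat \<Rightarrow> (nat \<Rightarrow> real) set" where
  "finball p = {x. (\<Sum>i\<le>p. (x i)\<^sup>2) \<le> 1 \<and> (\<forall>i>p. x i = 0)}"

text \<open>Without a zero, \<open>G\<close> could be normalised to unit length, and shrinking the
  sphere to the centre would make its identity map homotopic to a constant. The ball has the p + 1
  coordinates 0..p and vanishes beyond them, matching the encoding of
  \<open>nsphere p\<close>.\<close>

lemma finball_map_has_zero:
  fixes G :: "nat \<Rightarrow> (nat \<Rightarrow> real) \<Rightarrow> real"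
  assumes cont: "\<And>i. i \<le> p \<Longrightarrow> continuous_on (finball p) (G i)"
    and sphere: "\<And>x i. x \<in> finball p \<Longrightarrow> (\<Sum>j\<le>p. (x j)\<^sup>2) = 1 \<Longrightarrow> i \<le> p \<Longrightarrow> G i x = x i"
  shows "\<exists>x\<in>finball p. \<forall>i\<le>p. G i x = 0"
proof (rule ccontr)
  assume "\<not> ?thesis"
  then have nz: "\<exists>i\<le>p. G i x \<noteq> 0" if "x \<in> finball p" for x
    using that by blast
  define Q where "Q x = (\<Sum>i\<le>p. (G i x)\<^sup>2)" for x
  have Q_pos: "Q x > 0" if "x \<in> finball p" for x
  proof -
    obtain i where "i \<le> p" "G i x \<noteq> 0" using nz \<open>x \<in> finball p\<close> by blast
    then show ?thesis unfolding Q_def by (intro sum_pos2[of _ i]) auto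
  qed
  have Q_cont: "continuous_on (finball p) Q"
    unfolding Q_def by (intro continuous_intros cont) auto
  define S where "S = {x::nat \<Rightarrow> real. (\<Sum>i\<le>p. (x i)\<^sup>2) = 1 \<and> (\<forall>i>p. x i = 0)}"
  have nsphere_S: "nsphere p = top_of_set S"
    by (simp add: nsphere S_def euclidean_product_topology)
  have S_subset: "S \<subseteq> finball p" by (auto simp: S_def finball_def)
  define c where "c = (\<lambda>(t, x::nat \<Rightarrow> real) i. (1 - t) * x i)"
  have c_in: "c (t, x) \<in> finball p" if "t \<in> {0..1}" "x \<in> S" for t x
  proof -
    have "(\<Sum>i\<le>p. ((1 - t) * x i)\<^sup>2) = (1 - t)\<^sup>2"
      using \<open>x \<in> S\<close> by (simp add: S_def power_mult_distrib flip: sum_distrib_left)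
    also have "\<dots> \<le> 1" using \<open>t \<in> {0..1}\<close> by (simp add: power_le_one)
    finally show ?thesis using \<open>x \<in> S\<close> by (simp add: finball_def c_def S_def)
  qed
  have c_cont: "continuous_on ({0..1} \<times> S) c"
  proof (rule continuous_on_coordinatewise_then_product)
    fix i
    have "continuous_on ({0..1} \<times> S) (\<lambda>u. snd u i)"
      by (rule continuous_on_product_then_coordinatewise) (intro continuous_on_snd continuous_on_id)
    then show "continuous_on ({0..1} \<times> S) (\<lambda>u. c u i)"
      unfolding c_def case_prod_beta by (intro continuous_on_mult continuous_intros)
  qed
  have comp: "continuous_on ({0..1} \<times> S) (\<lambda>u. g (c u))" if "continuous_on (finball p) g" for g :: "_ \<Rightarrow> real"
    by (rule continuous_on_compose2[OF that c_cont]) (use c_in in auto)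
  \<comment> \<open>\<open>c\<close> moves the sphere radially to the centre, so \<open>G\<close>
    along \<open>c\<close>, divided by its length, starts at the identity and ends at a
    constant.\<close>
  define h where "h u = (\<lambda>i. if i \<le> p then G i (c u) / sqrt (Q (c u)) else 0)" for u
  have h_cont: "continuous_on ({0..1} \<times> S) h"
  proof (rule continuous_on_coordinatewise_then_product)
    fix i
    have "sqrt (Q (c u)) \<noteq> 0" if "u \<in> {0..1} \<times> S" for u
      using that Q_pos[OF c_in] by (cases u) (auto simp: less_imp_neq[symmetric])
    then show "continuous_on ({0..1} \<times> S) (\<lambda>u. h u i)"
      unfolding h_def using comp[OF cont, of i] comp[OF Q_cont]
      by (cases "i \<le> p") (simp_all add: continuous_on_divide continuous_on_real_sqrt)
  qed
  have h_in: "h u \<in> S" if "u \<in> {0..1} \<times> S" for u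
  proof -
    have "Q (c u) > 0" using that Q_pos[OF c_in] by (cases u) auto
    then show ?thesis
      by (simp add: S_def h_def power_divide flip: sum_divide_distrib) (simp add: Q_def)
  qed
  have h0: "h (0, x) = x" if "x \<in> S" for x
  proof -
    have "G i x = x i" if "i \<le> p" for i
      using sphere[of x i] S_subset \<open>x \<in> S\<close> that by (auto simp: S_def)
    then have "Q x = 1" using \<open>x \<in> S\<close> by (simp add: Q_def S_def)
    with \<open>\<And>i. i \<le> p \<Longrightarrow> G i x = x i\<close> show ?thesis
      using \<open>x \<in> S\<close> by (auto simp: h_def c_def S_def fun_eq_iff)
  qed
  have h1: "h (1, x) = h (1, \<lambda>_. 0)" for x
  proof -
    have "c (1, x) = c (1, \<lambda>_. 0)" by (simp add: c_def)
    then show ?thesis by (simp only: h_def)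
  qed
  have "homotopic_with (\<lambda>_. True) (top_of_set S) (top_of_set S) id (\<lambda>x. h (1, \<lambda>_. 0))"
  proof (subst homotopic_with, simp, intro exI[of _ h] conjI)
    show "continuous_map (prod_topology (top_of_set {0..1}) (top_of_set S)) (top_of_set S) h"
      using h_cont h_in by (auto simp: subtopology_Times[symmetric] continuous_map_in_subtopology)
  qed (auto simp: h0 intro: h1)
  then have "contractible_space (nsphere p)"
    unfolding contractible_space_def nsphere_S by blast
  then show False using non_contractible_space_nsphere by blast
qed

definition to_complex :: "(nat \<Rightarrow> real) \<Rightarrow> nat \<Rightarrow> complex" where
  "to_complex x j = Complex (x (2 * j)) (x (2 * j + 1))"

lemma sum_norm_to_complex: "(\<Sum>j<n. (cmod (to_complex x j))\<^sup>2) = (\<Sum>i<2 * n. (x i)\<^sup>2)"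
  by (induction n) (simp_all add: to_complex_def cmod_def)

text \<open>Interleaving real and imaginary parts turns C^n into R^(2n), whose unit sphere is
  \<open>nsphere (2 * n - 1)\<close>. Dividing by \<open>r\<close> makes the map the identity on
  that sphere.\<close>

lemma finball_complex_map_has_zero:
  fixes F :: "nat \<Rightarrow> (nat \<Rightarrow> real) \<Rightarrow> complex"
  assumes "n \<ge> 1" and "r \<noteq> 0"
    and cont: "\<And>j. j < n \<Longrightarrow> continuous_on (finball (2 * n - 1)) (F j)"
    and sphere: "\<And>x j. x \<in> finball (2 * n - 1) \<Longrightarrow> (\<Sum>k<n. (cmod (to_complex x k))\<^sup>2) = 1 \<Longrightarrow> j < n \<Longrightarrow>
           F j x = of_real r * to_complex x j"
  shows "\<exists>x\<in>finball (2 * n - 1). \<forall>j<n. F j x = 0"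
proof -
  define G where "G i x = (if even i then Re (F (i div 2) x) else Im (F (i div 2) x)) / r" for i x
  have "\<exists>x\<in>finball (2 * n - 1). \<forall>i\<le>2 * n - 1. G i x = 0"
  proof (rule finball_map_has_zero)
    fix i assume "i \<le> 2 * n - 1"
    then have "i div 2 < n" using \<open>n \<ge> 1\<close> by auto
    then show "continuous_on (finball (2 * n - 1)) (G i)"
      unfolding G_def using \<open>r \<noteq> 0\<close> cont[of "i div 2"]
      by (cases "even i") (simp_all add: continuous_intros)
  next
    fix x i
    assume x: "x \<in> finball (2 * n - 1)" and s: "(\<Sum>j\<le>2 * n - 1. (x j)\<^sup>2) = 1" and i: "i \<le> 2 * n - 1"
    have "{..<2 * n} = {..2 * n - 1}" using \<open>n \<ge> 1\<close> by auto
    then have "(\<Sum>k<n. (cmod (to_complex x k))\<^sup>2) = 1"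
      using s by (simp add: sum_norm_to_complex)
    moreover have "i div 2 < n" using i \<open>n \<ge> 1\<close> by auto
    ultimately have "F (i div 2) x = of_real r * to_complex x (i div 2)"
      using sphere x by blast
    then show "G i x = x i"
      using \<open>r \<noteq> 0\<close> by (auto simp: G_def to_complex_def elim: evenE oddE)
  qed
  then obtain x where x: "x \<in> finball (2 * n - 1)" and zero: "\<And>i. i \<le> 2 * n - 1 \<Longrightarrow> G i x = 0"
    by blast
  have "F j x = 0" if "j < n" for j
    using zero[of "2 * j"] zero[of "2 * j + 1"] that \<open>r \<noteq> 0\<close> by (auto simp: G_def complex_eq_iff)
  with x show ?thesis by blast
qed

section \<open>Characters and Dirichlet convolution\<close>

text \<open>The completely multiplicative function with prescribed values at the primes. At 0 it is
  an empty product, which is harmless because coefficient sums range over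
  \<open>{1..}\<close>.\<close>

definition mult_ext :: "(nat \<Rightarrow> complex) \<Rightarrow> nat \<Rightarrow> complex" where
  "mult_ext c n = (\<Prod>p\<in>#prime_factorization n. c p)"

lemma mult_ext_mult: "m > 0 \<Longrightarrow> n > 0 \<Longrightarrow> mult_ext c (m * n) = mult_ext c m * mult_ext c n"
  by (simp add: mult_ext_def prime_factorization_mult)

lemma mult_ext_1 [simp]: "mult_ext c (Suc 0) = 1"
  by (simp add: mult_ext_def prime_factorization_1[unfolded One_nat_def])

lemma mult_ext_prime: "prime p \<Longrightarrow> mult_ext c p = c p"
  by (simp add: mult_ext_def prime_factorization_prime)

lemma norm_mult_ext_le:
  assumes "\<And>p. prime p \<Longrightarrow> cmod (c p) \<le> 1 / (real p)\<^sup>2" and "n > 0"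
  shows "cmod (mult_ext c n) \<le> 1 / (real n)\<^sup>2"
  using \<open>n > 0\<close>
proof (induction n rule: prime_divisors_induct)
  case (factor p n)
  then have "cmod (mult_ext c (p * n)) = cmod (c p) * cmod (mult_ext c n)"
    by (simp add: mult_ext_mult mult_ext_prime norm_mult)
  also have "\<dots> \<le> 1 / (real p)\<^sup>2 * (1 / (real n)\<^sup>2)"
    using factor by (intro mult_mono assms(1)) auto
  finally show ?case by (simp add: power_mult_distrib)
qed auto

lemma continuous_on_mult_ext:
  assumes "\<And>p. prime p \<Longrightarrow> continuous_on A (\<lambda>x. c x p)" and "n > 0"
  shows "continuous_on A (\<lambda>x. mult_ext (c x) n)"
  using \<open>n > 0\<close>
proof (induction n rule: prime_divisors_induct)
  case (factor p n)
  then have "mult_ext (c x) (p * n) = c x p * mult_ext (c x) n" for x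
    by (simp add: mult_ext_mult mult_ext_prime)
  then show ?case using factor assms by (auto intro!: continuous_on_mult)
qed auto

text \<open>
  The coefficients of a series in \<^term>\<open>H_infinity\<close> grow at most like the square root of the
  index, so the decay required here makes every such series converge absolutely at the character.
\<close>

definition small_character :: "(nat \<Rightarrow> complex) \<Rightarrow> bool" where
  "small_character chi \<longleftrightarrow> chi 1 = 1 \<and> (\<forall>m>0. \<forall>n>0. chi (m * n) = chi m * chi n) \<and>
     (\<forall>n>0. cmod (chi n) \<le> 1 / (real n)\<^sup>2)"

lemma small_character_mult_ext:
  "(\<And>p. prime p \<Longrightarrow> cmod (c p) \<le> 1 / (real p)\<^sup>2) \<Longrightarrow> small_character (mult_ext c)"
  by (simp add: small_character_def mult_ext_mult norm_mult_ext_le)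

text \<open>Evaluating a series at the integer \<open>k\<close> is itself a small character, so what
  is shown for characters applies to the values that determine the coefficients.\<close>

lemma small_character_power:
  assumes "k \<ge> 2"
  shows "small_character (\<lambda>n. 1 / of_nat n ^ k)"
proof -
  have "1 / real n ^ k \<le> 1 / (real n)\<^sup>2" if "n > 0" for n
    using that assms by (intro divide_left_mono power_increasing) auto
  then show ?thesis by (simp add: small_character_def norm_divide norm_power power_mult_distrib)
qed

text \<open>Absolute convergence at s = 2, which dominates the sum at every small character.\<close>

definition coeff_summable :: "(nat \<Rightarrow> complex) \<Rightarrow> bool" where
  "coeff_summable a \<longleftrightarrow> (\<lambda>n. a n / of_nat n ^ 2) abs_summable_on {1..}"

definition coeff_sum :: "(nat \<Rightarrow> complex) \<Rightarrow> (nat \<Rightarrow> complex) \<Rightarrow> complex" where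
  "coeff_sum a chi = (\<Sum>\<^sub>\<infinity>n\<in>{1..}. a n * chi n)"

lemma coeff_sum_abs_summable:
  assumes "coeff_summable a" and "\<And>n. n > 0 \<Longrightarrow> cmod (chi n) \<le> 1 / (real n)\<^sup>2"
  shows "(\<lambda>n. a n * chi n) abs_summable_on {1..}"
proof (rule Infinite_Sum.abs_summable_on_comparison_test)
  show "(\<lambda>n. a n / of_nat n ^ 2) abs_summable_on {1..}"
    using assms(1) unfolding coeff_summable_def .
  fix n :: nat assume "n \<in> {1..}"
  then have "cmod (a n) * cmod (chi n) \<le> cmod (a n) * (1 / (real n)\<^sup>2)"
    by (intro mult_left_mono assms) auto
  then show "cmod (a n * chi n) \<le> cmod (a n / of_nat n ^ 2)"
    by (simp add: norm_mult norm_divide norm_power)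
qed

lemma coeff_sum_has_sum:
  assumes "coeff_summable a" and "\<And>n. n > 0 \<Longrightarrow> cmod (chi n) \<le> 1 / (real n)\<^sup>2"
  shows "((\<lambda>n. a n * chi n) has_sum coeff_sum a chi) {1..}"
  unfolding coeff_sum_def
  by (rule has_sum_infsum[OF abs_summable_summable[OF coeff_sum_abs_summable[OF assms]]])

lemma coeff_summable_add:
  "coeff_summable a \<Longrightarrow> coeff_summable b \<Longrightarrow> coeff_summable (\<lambda>n. a n + b n)"
  unfolding coeff_summable_def add_divide_distrib
  by (rule Infinite_Sum.abs_summable_on_comparison_test'[OF summable_on_add norm_triangle_ineq])

lemma coeff_summable_cmult: "coeff_summable a \<Longrightarrow> coeff_summable (\<lambda>n. c * a n)"
  unfolding coeff_summable_def
  by (simp add: norm_mult norm_divide summable_on_cmult_right flip: times_divide_eq_right)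

lemma coeff_sum_add:
  assumes "coeff_summable a" "coeff_summable b" and "\<And>n. n > 0 \<Longrightarrow> cmod (chi n) \<le> 1 / (real n)\<^sup>2"
  shows "coeff_sum (\<lambda>n. a n + b n) chi = coeff_sum a chi + coeff_sum b chi"
  using has_sum_add[OF coeff_sum_has_sum[OF assms(1,3)] coeff_sum_has_sum[OF assms(2,3)]]
  unfolding coeff_sum_def by (simp add: infsumI distrib_right)

lemma coeff_sum_cmult: "coeff_sum (\<lambda>n. c * a n) chi = c * coeff_sum a chi"
  unfolding coeff_sum_def by (simp add: mult.assoc infsum_cmult_right')

definition dirichlet_conv :: "(nat \<Rightarrow> complex) \<Rightarrow> (nat \<Rightarrow> complex) \<Rightarrow> nat \<Rightarrow> complex" where
  "dirichlet_conv a b n = (\<Sum>d | d dvd n. a d * b (n div d))"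

text \<open>The double series over pairs (d, e) converges absolutely, and complete multiplicativity
  merges chi(d) chi(e) into chi(d e); grouping the pairs by their product n = d e yields the
  convolution. The index (n, d) is used so that the fibre over n is the set of its divisors.\<close>

lemma dirichlet_conv_has_sum:
  assumes a: "coeff_summable a" and b: "coeff_summable b" and chi: "small_character chi"
  shows "(\<lambda>n. dirichlet_conv a b n * chi n) abs_summable_on {1..}"
    and "((\<lambda>n. dirichlet_conv a b n * chi n) has_sum (coeff_sum a chi * coeff_sum b chi)) {1..}"
proof -
  have bound: "cmod (chi n) \<le> 1 / (real n)\<^sup>2" if "n > 0" for n
    using chi that by (simp add: small_character_def)
  define S where "S = Sigma {1::nat..} (\<lambda>n. {d. d dvd n})"
  define f where "f = (\<lambda>(n, d). a d * b (n div d) * chi n)"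
  define g where "g = (\<lambda>(d, e). (a d * chi d) * (b e * chi e))"
  have bij: "bij_betw (\<lambda>(d, e). (d * e, d)) ({1..} \<times> {1..}) S"
    by (rule bij_betw_byWitness[of _ "\<lambda>(n, d). (d, n div d)"])
       (auto simp: S_def Suc_le_eq elim!: dvdE)
  have fg: "f ((\<lambda>(d, e). (d * e, d)) u) = g u" if "u \<in> {1..} \<times> {1..}" for u
    using that chi by (auto simp: f_def g_def small_character_def)
  note as = coeff_sum_abs_summable[OF a bound] and bs = coeff_sum_abs_summable[OF b bound]
  have g_abs: "g abs_summable_on {1..} \<times> {1..}"
    unfolding g_def
    by (subst Infinite_Sum.abs_summable_on_Sigma_iff)
       (use as bs in \<open>auto simp: norm_mult infsum_cmult_right' infsum_nonneg abs_mult
          intro!: summable_on_cmult_right summable_on_cmult_left\<close>)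
  have f_abs: "f abs_summable_on S"
    unfolding summable_on_reindex_bij_betw[OF bij, symmetric]
    by (subst summable_on_cong[OF arg_cong[of _ _ norm, OF fg]]) (use g_abs in auto)
  have conv: "dirichlet_conv a b n * chi n = (\<Sum>d | d dvd n. f (n, d))" for n
    by (simp add: dirichlet_conv_def f_def sum_distrib_right)
  have fin: "finite {d. d dvd n}" if "n \<in> {1..}" for n :: nat
    using that by auto
  show "(\<lambda>n. dirichlet_conv a b n * chi n) abs_summable_on {1..}"
  proof (rule Infinite_Sum.abs_summable_on_comparison_test)
    show "(\<lambda>n. \<Sum>\<^sub>\<infinity>d\<in>{d. d dvd n}. norm (f (n, d))) abs_summable_on {1..}"
      using Infinite_Sum.abs_summable_on_Sigma_iff[THEN iffD1, OF f_abs[unfolded S_def]] by (rule conjunct2)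
    show "norm (dirichlet_conv a b n * chi n) \<le> norm (\<Sum>\<^sub>\<infinity>d\<in>{d. d dvd n}. norm (f (n, d)))"
      if "n \<in> {1..}" for n
      unfolding conv infsum_finite[OF fin[OF that]] real_norm_def
      by (rule order_trans[OF norm_sum abs_ge_self])
  qed
  \<comment> \<open>One double sum is evaluated in two orders: summing over e first gives the
    product of the two sums, and after reindexing, summing over divisors first gives the
    convolution.\<close>
  have "(g has_sum infsum g ({1..} \<times> {1..})) ({1..} \<times> {1..})"
    by (rule has_sum_infsum[OF abs_summable_summable[OF g_abs]])
  then have "((\<lambda>d. a d * chi d * coeff_sum b chi) has_sum infsum g ({1..} \<times> {1..})) {1..}"
    by (rule has_sum_SigmaD)
       (unfold g_def prod.case, intro has_sum_cmult_right coeff_sum_has_sum b bound)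
  moreover have "((\<lambda>d. a d * chi d * coeff_sum b chi) has_sum coeff_sum a chi * coeff_sum b chi) {1..}"
    by (intro has_sum_cmult_left coeff_sum_has_sum a bound)
  ultimately have inf: "infsum g ({1..} \<times> {1..}) = coeff_sum a chi * coeff_sum b chi"
    by (rule has_sum_unique)
  have "(g has_sum coeff_sum a chi * coeff_sum b chi) ({1..} \<times> {1..})"
    using \<open>(g has_sum _) _\<close> unfolding inf .
  then have "(f has_sum coeff_sum a chi * coeff_sum b chi) S"
    unfolding has_sum_reindex_bij_betw[OF bij, symmetric]
    by (subst has_sum_cong[OF fg]) auto
  then show "((\<lambda>n. dirichlet_conv a b n * chi n) has_sum (coeff_sum a chi * coeff_sum b chi)) {1..}"
    unfolding S_def
    by (rule has_sum_SigmaD) (use fin in \<open>auto simp: conv intro!: has_sum_finite\<close>)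
qed

lemma coeff_summable_dirichlet_conv:
  assumes "coeff_summable a" "coeff_summable b"
  shows "coeff_summable (dirichlet_conv a b)"
  using dirichlet_conv_has_sum(1)[OF assms small_character_power[of 2]]
  by (simp add: coeff_summable_def)

lemma coeff_sum_dirichlet_conv:
  assumes "coeff_summable a" "coeff_summable b" "small_character chi"
  shows "coeff_sum (dirichlet_conv a b) chi = coeff_sum a chi * coeff_sum b chi"
  unfolding coeff_sum_def[of "dirichlet_conv a b"]
  by (rule infsumI[OF dirichlet_conv_has_sum(2)[OF assms]])

text \<open>Strong induction: once the earlier coefficients vanish, multiplying the k-th power sum
  by m^k leaves c(m) plus terms with factors (m/n)^k for n > m, which tend to 0 as k grows.\<close>

lemma coeff_zero_if_power_sums_zero:
  assumes c: "coeff_summable c"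
    and zero: "\<And>k. k \<ge> 2 \<Longrightarrow> coeff_sum c (\<lambda>n. 1 / of_nat n ^ k) = 0"
  shows "n \<ge> 1 \<Longrightarrow> c n = 0"
proof (induction n rule: less_induct)
  case (less m)
  define C where "C = (\<Sum>\<^sub>\<infinity>n\<in>{1..}. cmod (c n / of_nat n ^ 2))"
  \<comment> \<open>\<open>q\<close> is the largest ratio m/n with n > m. The exponent is taken as
    \<open>k + 2\<close> so that n^-2 stays with the absolutely summable coefficients and (m/n)^k is
    left to decay.\<close>
  define q where "q = real m / real (Suc m)"
  have bound: "cmod (c m) \<le> (real m)\<^sup>2 * C * q ^ k" for k
  proof -
    have k2: "k + 2 \<ge> 2" by simp
    define u where "u n = c n * (1 / of_nat n ^ (k + 2))" for n
    have bnd: "cmod (1 / of_nat n ^ (k + 2)) \<le> 1 / (real n)\<^sup>2" if "n > 0" for n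
      using small_character_power[OF k2] that unfolding small_character_def by blast
    have "(u has_sum 0) {1..}"
      using coeff_sum_has_sum[OF c bnd] unfolding u_def zero[OF k2] .
    \<comment> \<open>Adding this one-term series deletes index \<open>m\<close>; by the induction
      hypothesis only indices n > m remain, and they sum to \<open>- u m\<close>.\<close>
    moreover have "((\<lambda>n. if n = m then - u n else 0) has_sum - u m) {1..}"
      using less.prems by (intro has_sum_finite_neutralI[of "{m}"]) auto
    ultimately have "((\<lambda>n. u n + (if n = m then - u n else 0)) has_sum 0 + - u m) {1..}"
      by (rule has_sum_add)
    then have "((\<lambda>n. of_nat m ^ (k + 2) * (u n + (if n = m then - u n else 0))) has_sum
        of_nat m ^ (k + 2) * (- u m)) {1..}"
      by (intro has_sum_cmult_right) simp
    moreover have "((\<lambda>n. cmod (c n / of_nat n ^ 2) * ((real m)\<^sup>2 * q ^ k)) has_sum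
        C * ((real m)\<^sup>2 * q ^ k)) {1..}"
      unfolding C_def
      using c by (intro has_sum_cmult_left has_sum_infsum) (simp add: coeff_summable_def)
    moreover have "norm (of_nat m ^ (k + 2) * (u n + (if n = m then - u n else 0)))
        \<le> cmod (c n / of_nat n ^ 2) * ((real m)\<^sup>2 * q ^ k)" if "n \<in> {1..}" for n
    proof (cases "n > m")
      case True
      have "real m / real n \<le> q"
        unfolding q_def using True by (intro divide_left_mono) auto
      then have "(real m / real n) ^ k \<le> q ^ k" by (intro power_mono) auto
      then have "cmod (c n) / real n ^ 2 * (real m)\<^sup>2 * (real m / real n) ^ k
          \<le> cmod (c n) / real n ^ 2 * (real m)\<^sup>2 * q ^ k"
        by (intro mult_left_mono) auto
      moreover have "norm (of_nat m ^ (k + 2) * u n) =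
          cmod (c n) / real n ^ 2 * (real m)\<^sup>2 * (real m / real n) ^ k"
        by (simp add: u_def norm_mult norm_divide norm_power power_add power_divide power2_eq_square mult_ac)
      ultimately show ?thesis
        using True by (simp add: norm_divide norm_power mult.assoc)
    next
      case False
      then have "u n + (if n = m then - u n else 0) = 0"
        using less.IH[of n] that by (auto simp: u_def)
      then show ?thesis by (simp add: q_def)
    qed
    ultimately have "norm (of_nat m ^ (k + 2) * (- u m)) \<le> C * ((real m)\<^sup>2 * q ^ k)"
      by (rule norm_infsum_le)
    moreover have "of_nat m ^ (k + 2) * (- u m) = - c m"
      using less.prems by (simp add: u_def)
    ultimately show ?thesis by (simp add: mult_ac)
  qed
  have "(\<lambda>k. q ^ k) \<longlonglongrightarrow> 0"
    by (rule LIMSEQ_power_zero) (simp add: q_def)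
  then have "(\<lambda>k. (real m)\<^sup>2 * C * q ^ k) \<longlonglongrightarrow> (real m)\<^sup>2 * C * 0"
    by (rule tendsto_mult_left)
  then have lim: "(\<lambda>k. (real m)\<^sup>2 * C * q ^ k) \<longlonglongrightarrow> 0" by simp
  have "cmod (c m) \<le> 0"
    by (rule LIMSEQ_le_const[OF lim]) (use bound in blast)
  then show ?case by simp
qed

section \<open>Evaluation of functions at characters\<close>

text \<open>
  The values at the integers from 2 onwards determine the coefficients, except for the irrelevant
  \<open>a 0\<close>, and convergence there is absolute.
\<close>

definition dirichlet_coeffs :: "(complex \<Rightarrow> complex) \<Rightarrow> (nat \<Rightarrow> complex) \<Rightarrow> bool" where
  "dirichlet_coeffs f a \<longleftrightarrow>
     coeff_summable a \<and> (\<forall>k\<ge>2. f (of_nat k) = coeff_sum a (\<lambda>n. 1 / of_nat n ^ k))"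

text \<open>A choice of coefficients makes the character act on functions. The choice does not
  matter: coefficients are unique at positive indices, and \<open>coeff_sum\<close> ignores index
  0.\<close>

definition dirichlet_eval :: "(nat \<Rightarrow> complex) \<Rightarrow> (complex \<Rightarrow> complex) \<Rightarrow> complex" where
  "dirichlet_eval chi f = coeff_sum (SOME a. dirichlet_coeffs f a) chi"

lemma power_le_inverse_square:
  assumes "k \<ge> 2" "n > 0"
  shows "cmod (1 / of_nat n ^ k) \<le> 1 / (real n)\<^sup>2"
  using small_character_power[OF assms(1)] assms(2) unfolding small_character_def by blast

lemma dirichlet_coeffs_unique:
  assumes a: "dirichlet_coeffs f a" and b: "dirichlet_coeffs f b" and "n \<ge> 1"
  shows "a n = b n"
proof -
  have sa: "coeff_summable a" and sb: "coeff_summable (\<lambda>n. - 1 * b n)"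
    using a b coeff_summable_cmult[of b "-1"] by (auto simp: dirichlet_coeffs_def)
  have "a n + - 1 * b n = 0"
  proof (rule coeff_zero_if_power_sums_zero[OF coeff_summable_add[OF sa sb] _ \<open>n \<ge> 1\<close>])
    fix k :: nat assume "k \<ge> 2"
    then show "coeff_sum (\<lambda>n. a n + - 1 * b n) (\<lambda>n. 1 / of_nat n ^ k) = 0"
      using a b by (subst coeff_sum_add[OF sa sb power_le_inverse_square])
        (simp_all only: coeff_sum_cmult dirichlet_coeffs_def, simp)
  qed
  then show ?thesis by simp
qed

lemma dirichlet_eval_eq:
  assumes "dirichlet_coeffs f a"
  shows "dirichlet_eval chi f = coeff_sum a chi"
proof -
  have "dirichlet_coeffs f (SOME a. dirichlet_coeffs f a)"
    using assms by (rule someI[where P = "dirichlet_coeffs f"])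
  then have "(SOME a. dirichlet_coeffs f a) n = a n" if "n \<in> {1..}" for n
    using dirichlet_coeffs_unique assms that by simp
  then show ?thesis
    unfolding dirichlet_eval_def coeff_sum_def by (intro infsum_cong) simp
qed

lemma of_nat_in_half_plane: "k \<ge> 2 \<Longrightarrow> of_nat k \<in> right_half_plane"
  by (simp add: right_half_plane_def)

lemma dirichlet_coeffs_add:
  assumes "dirichlet_coeffs f a" "dirichlet_coeffs g b"
  shows "dirichlet_coeffs (fun_add f g) (\<lambda>n. a n + b n)"
  unfolding dirichlet_coeffs_def
proof (intro conjI allI impI)
  show "coeff_summable (\<lambda>n. a n + b n)"
    using assms by (simp add: dirichlet_coeffs_def coeff_summable_add)
  fix k :: nat assume k: "k \<ge> 2"
  have "fun_add f g (of_nat k) = f (of_nat k) + g (of_nat k)"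
    using of_nat_in_half_plane[OF k] by (simp add: fun_add_def)
  also have "\<dots> = coeff_sum a (\<lambda>n. 1 / of_nat n ^ k) + coeff_sum b (\<lambda>n. 1 / of_nat n ^ k)"
    using assms k by (simp add: dirichlet_coeffs_def)
  also have "\<dots> = coeff_sum (\<lambda>n. a n + b n) (\<lambda>n. 1 / of_nat n ^ k)"
    using assms power_le_inverse_square[OF k]
    by (intro coeff_sum_add[symmetric]) (simp_all add: dirichlet_coeffs_def)
  finally show "fun_add f g (of_nat k) = coeff_sum (\<lambda>n. a n + b n) (\<lambda>n. 1 / of_nat n ^ k)" .
qed

lemma dirichlet_coeffs_mult:
  assumes "dirichlet_coeffs f a" "dirichlet_coeffs g b"
  shows "dirichlet_coeffs (fun_mult f g) (dirichlet_conv a b)"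
  using assms
  by (auto simp: dirichlet_coeffs_def fun_mult_def of_nat_in_half_plane coeff_summable_dirichlet_conv
      coeff_sum_dirichlet_conv small_character_power)

lemma dirichlet_eval_add:
  assumes "dirichlet_coeffs f a" "dirichlet_coeffs g b" "small_character chi"
  shows "dirichlet_eval chi (fun_add f g) = dirichlet_eval chi f + dirichlet_eval chi g"
  unfolding dirichlet_eval_eq[OF dirichlet_coeffs_add[OF assms(1,2)]] dirichlet_eval_eq[OF assms(1)] dirichlet_eval_eq[OF assms(2)]
  using assms by (intro coeff_sum_add) (auto simp: dirichlet_coeffs_def small_character_def)

lemma dirichlet_eval_mult:
  assumes "dirichlet_coeffs f a" "dirichlet_coeffs g b" "small_character chi"
  shows "dirichlet_eval chi (fun_mult f g) = dirichlet_eval chi f * dirichlet_eval chi g"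
  unfolding dirichlet_eval_eq[OF dirichlet_coeffs_mult[OF assms(1,2)]] dirichlet_eval_eq[OF assms(1)] dirichlet_eval_eq[OF assms(2)]
  using assms by (intro coeff_sum_dirichlet_conv) (auto simp: dirichlet_coeffs_def)

text \<open>Weierstrass test: |a(n)| / n^2 is a summable majorant that does not depend on the
  parameter, and each term is continuous.\<close>

lemma continuous_on_dirichlet_eval:
  assumes f: "dirichlet_coeffs f a"
    and chi: "\<And>x. x \<in> A \<Longrightarrow> small_character (chi x)"
    and cont: "\<And>n. n \<ge> 1 \<Longrightarrow> continuous_on A (\<lambda>x. chi x n)"
  shows "continuous_on A (\<lambda>x. dirichlet_eval (chi x) f)"
  unfolding dirichlet_eval_eq[OF f] coeff_sum_def
proof (rule uniform_limit_theorem)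
  show "uniform_limit A (\<lambda>X x. \<Sum>n\<in>X. a n * chi x n) (\<lambda>x. \<Sum>\<^sub>\<infinity>n\<in>{1..}. a n * chi x n)
      (finite_subsets_at_top {1..})"
  proof (rule Weierstrass_m_test_general)
    show "(\<lambda>n. norm (a n / of_nat n ^ 2)) summable_on {1..}"
      using f unfolding dirichlet_coeffs_def coeff_summable_def by blast
    fix n x assume "n \<in> {1::nat..}" "x \<in> A"
    then have "cmod (a n) * cmod (chi x n) \<le> cmod (a n) * (1 / (real n)\<^sup>2)"
      using chi[of x] by (intro mult_left_mono) (auto simp: small_character_def)
    then show "norm (a n * chi x n) \<le> norm (a n / of_nat n ^ 2)"
      by (simp add: norm_mult norm_divide norm_power)
  qed
  show "\<forall>\<^sub>F X in finite_subsets_at_top {1..}. continuous_on A (\<lambda>x. \<Sum>n\<in>X. a n * chi x n)"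
    by (rule eventually_finite_subsets_at_top_weakI) (auto intro!: continuous_intros cont)
qed simp

text \<open>Convergence at s = 1/2 makes a(n) / n^(1/2) bounded, so a(n) / n^2 is dominated by a
  multiple of the summable n^(-3/2). This holds even where the series itself converges only
  conditionally.\<close>

lemma dirichlet_coeffs_of_H_infinity:
  assumes "f \<in> H_infinity"
  obtains a where "dirichlet_coeffs f a"
proof -
  obtain a where a: "\<And>s. s \<in> right_half_plane \<Longrightarrow> (\<lambda>n. a (Suc n) / of_nat (Suc n) powr s) sums f s"
    using assms by (auto simp: H_infinity_def)
  have "(\<lambda>n. a (Suc n) / of_nat (Suc n) powr (1 / 2)) \<longlonglongrightarrow> 0"
    by (rule summable_LIMSEQ_zero[OF sums_summable[OF a]]) (simp add: right_half_plane_def)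
  then have "Bseq (\<lambda>n. a (Suc n) / of_nat (Suc n) powr (1 / 2))"
    by (intro convergent_imp_Bseq convergentI)
  then obtain M where M: "\<And>n. cmod (a (Suc n) / of_nat (Suc n) powr (1 / 2)) \<le> M" "M > 0"
    by (auto simp: Bseq_def)
  have "coeff_summable a"
    unfolding coeff_summable_def
  proof (rule Infinite_Sum.abs_summable_on_comparison_test')
    have "summable (\<lambda>n. M * real n powr (-3/2))"
      by (intro summable_mult) (simp add: summable_real_powr_iff)
    then have "(\<lambda>n. M * real n powr (-3/2)) summable_on UNIV"
      using M(2) by (intro summable_nonneg_imp_summable_on) auto
    then show "(\<lambda>n. M * real n powr (-3/2)) summable_on {1..}"
      by (rule summable_on_subset) simp
    fix n :: nat assume "n \<in> {1..}"
    then obtain k where n: "n = Suc k" by (cases n) auto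
    have "cmod (a n) / real n powr (1/2) \<le> M"
      using M(1)[of k] unfolding n by (simp only: norm_divide) (simp add: norm_powr_real_powr)
    then have "cmod (a n) \<le> M * real n powr (1/2)"
      using n by (simp add: pos_divide_le_eq)
    then have "cmod (a n) / (real n)\<^sup>2 \<le> M * real n powr (1/2) / (real n)\<^sup>2"
      by (rule divide_right_mono) simp
    also have "\<dots> = M * (real n powr (1/2) / real n powr 2)"
      using n by (simp add: powr_numeral)
    also have "real n powr (1/2) / real n powr 2 = real n powr (1/2 - 2)"
      by (rule powr_diff[symmetric])
    also have "1/2 - 2 = (-3/2 :: real)" by simp
    finally show "norm (a n / of_nat n ^ 2) \<le> M * real n powr (-3/2)"
      by (simp add: norm_divide norm_power)
  qed
  moreover have "f (of_nat k) = coeff_sum a (\<lambda>n. 1 / of_nat n ^ k)" if k: "k \<ge> 2" for k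
  proof -
    have bij: "bij_betw Suc UNIV {1..}"
      by (rule bij_betw_byWitness[of _ "\<lambda>n. n - 1"]) auto
    have "((\<lambda>n. a n * (1 / of_nat n ^ k)) has_sum coeff_sum a (\<lambda>n. 1 / of_nat n ^ k)) {1..}"
      by (rule coeff_sum_has_sum[OF \<open>coeff_summable a\<close> power_le_inverse_square[OF k]])
    then have "((\<lambda>n. a (Suc n) * (1 / of_nat (Suc n) ^ k)) has_sum
        coeff_sum a (\<lambda>n. 1 / of_nat n ^ k)) UNIV"
      unfolding has_sum_reindex_bij_betw[OF bij, symmetric] .
    then have "(\<lambda>n. a (Suc n) * (1 / of_nat (Suc n) ^ k)) sums coeff_sum a (\<lambda>n. 1 / of_nat n ^ k)"
      by (rule has_sum_imp_sums)
    moreover have "(\<lambda>n. a (Suc n) * (1 / of_nat (Suc n) ^ k)) sums f (of_nat k)"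
      using a[OF of_nat_in_half_plane[OF k]] k by (simp add: powr_nat' del: of_nat_Suc)
    ultimately show ?thesis by (rule sums_unique2[symmetric])
  qed
  ultimately show ?thesis using that unfolding dirichlet_coeffs_def by blast
qed

section \<open>Holomorphy of Dirichlet series\<close>

text \<open>Abel summation: \<open>A\<close> holds partial sums, and \<open>A 0 = 0\<close> removes
  the lower boundary term.\<close>

lemma partial_summation:
  fixes A u :: "nat \<Rightarrow> complex"
  assumes "A 0 = 0"
  shows "(\<Sum>n<N. (A (Suc n) - A n) * u n) = A N * u N + (\<Sum>n<N. A (Suc n) * (u n - u (Suc n)))"
  by (induction N) (simp_all add: assms algebra_simps)

text \<open>Mean value estimate for z^(-w) on the segment from n + 1 to n + 2. Compared with a
  single term, the difference gains a factor of order 1/n, which is what makes the series after Abel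
  summation converge absolutely.\<close>

lemma norm_powr_diff_Suc_le:
  assumes "Re w > 0"
  shows "cmod (of_nat (Suc n) powr (-w) - of_nat (Suc (Suc n)) powr (-w))
    \<le> cmod w * real (Suc n) powr (- Re w - 1)"
proof -
  define S where "S = closed_segment (of_nat (Suc n)) (of_nat (Suc (Suc n)) :: complex)"
  have S: "z \<in> \<real> \<and> Re z \<ge> real (Suc n)" if "z \<in> S" for z
  proof -
    have "\<exists>t. 0 \<le> t \<and> t \<le> 1 \<and>
        z = (1 - t) *\<^sub>R of_nat (Suc n) + t *\<^sub>R of_nat (Suc (Suc n))"
      using that unfolding S_def in_segment .
    then obtain t where "0 \<le> t" "z = (1 - t) *\<^sub>R of_nat (Suc n) + t *\<^sub>R of_nat (Suc (Suc n))"
      by blast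
    then have "z = of_real (real (Suc n) + t)"
      by (simp add: scaleR_conv_of_real algebra_simps)
    with \<open>0 \<le> t\<close> show ?thesis by simp
  qed
  have "cmod (of_nat (Suc (Suc n)) powr (-w) - of_nat (Suc n) powr (-w))
    \<le> cmod w * real (Suc n) powr (- Re w - 1) * cmod (of_nat (Suc (Suc n)) - of_nat (Suc n))"
  proof (rule field_differentiable_bound)
    show "convex S" unfolding S_def by (rule convex_closed_segment)
    fix z assume "z \<in> S"
    then have z: "z \<in> \<real>" "Re z \<ge> real (Suc n)" using S by auto
    have "z \<notin> \<real>\<^sub>\<le>\<^sub>0" using z by (auto simp: complex_nonpos_Reals_iff)
    then show "((\<lambda>z. z powr (-w)) has_field_derivative (- w * z powr (- w - 1))) (at z within S)"
      by (intro has_field_derivative_powr[THEN has_field_derivative_at_within])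
    have "cmod (z powr (- w - 1)) = Re z powr (- Re w - 1)"
      using z by (subst norm_powr_real_powr) auto
    also have "\<dots> \<le> real (Suc n) powr (- Re w - 1)"
      using z assms by (intro powr_mono2') auto
    finally show "cmod (- w * z powr (- w - 1)) \<le> cmod w * real (Suc n) powr (- Re w - 1)"
      by (simp add: norm_mult mult_left_mono)
  qed (auto simp: S_def)
  then show ?thesis by (simp add: norm_minus_commute)
qed

text \<open>Conditional convergence provides no majorant for the series itself. Abel summation
  against the bounded partial sums at a point \<sigma> to the left replaces it by a series that
  converges locally uniformly, so that its sum is holomorphic.\<close>

lemma dirichlet_series_holomorphic:
  assumes f: "\<And>s. s \<in> right_half_plane \<Longrightarrow> (\<lambda>n. a (Suc n) / of_nat (Suc n) powr s) sums f s"
  shows "f holomorphic_on right_half_plane"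
proof -
  have "f field_differentiable (at x)" if x: "x \<in> right_half_plane" for x
  proof -
    \<comment> \<open>A quarter leaves room twice: x has real part 4\<sigma> and lies in the open
      set \<open>S\<close>, while on \<open>S\<close> the real part of s - \<sigma> exceeds
      \<sigma>, which gives the summable exponent -\<sigma> - 1.\<close>
    define \<sigma> where "\<sigma> = Re x / 4"
    have \<sigma>: "\<sigma> > 0" using x by (simp add: \<sigma>_def right_half_plane_def)
    define S where "S = {s. Re s > 2 * \<sigma>}"
    have "open S" unfolding S_def by (rule open_halfspace_Re_gt)
    define A where "A N = (\<Sum>n<N. a (Suc n) / of_nat (Suc n) powr of_real \<sigma>)" for N
    have "A \<longlonglongrightarrow> f (of_real \<sigma>)"
      using f[of "of_real \<sigma>"] \<sigma> unfolding sums_def A_def by (simp add: right_half_plane_def)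
    then have "Bseq A" by (intro convergent_imp_Bseq convergentI)
    then obtain M where M: "\<And>n. cmod (A n) \<le> M" "M > 0"
      by (auto simp: Bseq_def)
    define u where "u s n = of_nat (Suc n) powr (- (s - of_real \<sigma>))" for s :: complex and n
    define T where "T n s = A (Suc n) * (u s n - u s (Suc n))" for n s
    have T_bound: "cmod (T n s) \<le> M * (cmod (s - of_real \<sigma>) * real (Suc n) powr (- \<sigma> - 1))"
      if "s \<in> S" for n s
    proof -
      have Re: "Re (s - of_real \<sigma>) > \<sigma>" using that by (simp add: S_def)
      have "cmod (u s n - u s (Suc n))
          \<le> cmod (s - of_real \<sigma>) * real (Suc n) powr (- Re (s - of_real \<sigma>) - 1)"
        unfolding u_def by (rule norm_powr_diff_Suc_le) (use Re \<sigma> in linarith)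
      also have "\<dots> \<le> cmod (s - of_real \<sigma>) * real (Suc n) powr (- \<sigma> - 1)"
        using Re by (intro mult_left_mono powr_mono) auto
      finally show ?thesis
        unfolding T_def norm_mult using M by (intro mult_mono) (auto intro: order_trans[OF norm_ge_zero])
    qed
    have T_sums: "(\<lambda>n. T n s) sums f s" if s: "s \<in> S" for s
    proof -
      have Re: "Re (s - of_real \<sigma>) > \<sigma>" using s by (simp add: S_def)
      have "s \<in> right_half_plane" using s \<sigma> by (simp add: S_def right_half_plane_def)
      have summand: "(A (Suc n) - A n) * u s n = a (Suc n) / of_nat (Suc n) powr s" for n
      proof -
        have "u s n = of_nat (Suc n) powr of_real \<sigma> / of_nat (Suc n) powr s"
          unfolding u_def by (subst powr_diff[symmetric]) simp
        then show ?thesis by (simp add: A_def del: of_nat_Suc)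
      qed
      have u0: "(\<lambda>N. u s N) \<longlonglongrightarrow> 0"
      proof (rule tendsto_norm_zero_cancel)
        have "cmod (u s N) = real (Suc N) powr (- Re (s - of_real \<sigma>))" for N
          unfolding u_def by (subst norm_powr_real_powr) auto
        moreover have "(\<lambda>N. real (Suc N) powr (- Re (s - of_real \<sigma>))) \<longlonglongrightarrow> 0"
          using Re \<sigma>
          by (intro tendsto_neg_powr filterlim_compose[OF filterlim_real_sequentially filterlim_Suc]) auto
        ultimately show "(\<lambda>N. cmod (u s N)) \<longlonglongrightarrow> 0" by presburger
      qed
      have "(\<lambda>N. A N * u s N) \<longlonglongrightarrow> 0"
        using tendsto_mult[OF \<open>A \<longlonglongrightarrow> _\<close> u0] by simp
      moreover have "(\<lambda>N. \<Sum>n<N. (A (Suc n) - A n) * u s n) \<longlonglongrightarrow> f s"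
        using f[OF \<open>s \<in> right_half_plane\<close>] unfolding summand sums_def .
      ultimately have "(\<lambda>N. (\<Sum>n<N. (A (Suc n) - A n) * u s n) - A N * u s N) \<longlonglongrightarrow> f s - 0"
        by (intro tendsto_diff)
      moreover have "(\<Sum>n<N. (A (Suc n) - A n) * u s n) - A N * u s N = (\<Sum>n<N. T n s)" for N
        using partial_summation[of A "u s" N] by (simp add: T_def A_def)
      ultimately show ?thesis unfolding sums_def by simp
    qed
    obtain g where g: "\<forall>s\<in>S. (\<lambda>n. T n s) sums g s \<and> g field_differentiable (at s)"
    proof (rule series_differentiable_comparison_complex[OF \<open>open S\<close>])
      show "T n field_differentiable at s" if "s \<in> S" for n s
      proof -
        have "T n holomorphic_on UNIV"
          unfolding T_def u_def by (intro holomorphic_intros)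
        then show ?thesis by (simp add: holomorphic_on_imp_differentiable_at)
      qed
      fix s assume "s \<in> S"
      \<comment> \<open>\<open>K\<close> bounds |y - \<sigma>| on the unit ball around s, making the
        majorant uniform there.\<close>
      define K where "K = cmod s + 1 + \<sigma>"
      define h where "h n = complex_of_real (M * (K * real (Suc n) powr (- \<sigma> - 1)))" for n
      have "summable (\<lambda>n. real n powr (- \<sigma> - 1))" using \<sigma> by (simp add: summable_real_powr_iff)
      then have "summable (\<lambda>n. real (Suc n) powr (- \<sigma> - 1))" by (subst summable_Suc_iff)
      then have "summable h" unfolding h_def
        by (intro summable_of_real summable_mult)
      moreover have "range h \<subseteq> \<real>\<^sub>\<ge>\<^sub>0"
        using M \<sigma> by (auto simp: h_def K_def intro!: mult_nonneg_nonneg)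
      moreover have "cmod (T n y) \<le> cmod (h n)" if "y \<in> ball s 1 \<inter> S" for n y
      proof -
        have "cmod y \<le> cmod s + 1"
          using that norm_triangle_ineq3[of s y] by (auto simp: dist_norm)
        then have "cmod (y - of_real \<sigma>) \<le> K"
          using norm_triangle_ineq4[of y "of_real \<sigma>"] \<sigma> by (simp add: K_def)
        then have "M * (cmod (y - of_real \<sigma>) * real (Suc n) powr (- \<sigma> - 1))
            \<le> M * (K * real (Suc n) powr (- \<sigma> - 1))"
          using M by (intro mult_left_mono mult_right_mono) auto
        also have "\<dots> \<le> cmod (h n)" unfolding h_def norm_of_real by (rule abs_ge_self)
        finally show ?thesis using T_bound[of y n] that by auto
      qed
      ultimately show "\<exists>d h. 0 < d \<and> summable h \<and> range h \<subseteq> \<real>\<^sub>\<ge>\<^sub>0 \<and>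
          (\<forall>\<^sub>F n in sequentially. \<forall>y\<in>ball s d \<inter> S. cmod (T n y) \<le> cmod (h n))"
        by (intro exI[of _ 1] exI[of _ h]) (auto intro: always_eventually)
    qed blast
    have "x \<in> S" using \<sigma> by (simp add: S_def \<sigma>_def)
    have "g s = f s" if "s \<in> S" for s
      using g T_sums[OF that] that sums_unique2 by blast
    moreover obtain D where "(g has_field_derivative D) (at x)"
      using g \<open>x \<in> S\<close> unfolding field_differentiable_def by blast
    ultimately have "(f has_field_derivative D) (at x)"
      using has_field_derivative_transform_within_open \<open>open S\<close> \<open>x \<in> S\<close> by blast
    then show ?thesis unfolding field_differentiable_def by blast
  qed
  then show ?thesis
    unfolding holomorphic_on_def using field_differentiable_at_within by blast
qed

lemma H_infinity_holomorphic: "f \<in> H_infinity \<Longrightarrow> f holomorphic_on right_half_plane"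
  unfolding H_infinity_def using dirichlet_series_holomorphic by blast

section \<open>The ring of functions with derivatives in the algebra\<close>

lemma open_half_plane: "open right_half_plane"
  unfolding right_half_plane_def by (rule open_halfspace_Re_gt)

text \<open>Derivatives on an open set see only the values on it, so restricted functions may be
  exchanged for their natural extensions before differentiating.\<close>

lemma fun_deriv_cong:
  assumes "f holomorphic_on right_half_plane"
    and "\<And>s. s \<in> right_half_plane \<Longrightarrow> f s = g s"
  shows "fun_deriv l f = fun_deriv l g"
  unfolding fun_deriv_def
proof (rule restrict_ext)
  fix s assume "s \<in> right_half_plane"
  then show "(deriv ^^ l) f s = (deriv ^^ l) g s"
    using assms holomorphic_transform[OF assms]
    by (intro higher_deriv_transform_within_open[OF assms(1) _ open_half_plane]) auto
qed

lemma fun_deriv_add: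
  assumes "f holomorphic_on right_half_plane" "g holomorphic_on right_half_plane"
  shows "fun_deriv l (fun_add f g) = fun_add (fun_deriv l f) (fun_deriv l g)"
proof -
  have "fun_deriv l (fun_add f g) = fun_deriv l (\<lambda>s. f s + g s)"
    by (rule fun_deriv_cong[symmetric]) (auto simp: fun_add_def intro!: holomorphic_intros assms)
  also have "\<dots> = fun_add (fun_deriv l f) (fun_deriv l g)"
    unfolding fun_deriv_def fun_add_def
    by (rule restrict_ext) (simp add: higher_deriv_add[OF assms open_half_plane])
  finally show ?thesis .
qed

text \<open>Leibniz rule, written with the pointwise operations so that closure of \<open>B\<close>
  under finite sums applies to it.\<close>

lemma fun_deriv_mult:
  assumes "f holomorphic_on right_half_plane" "g holomorphic_on right_half_plane"
  shows "fun_deriv l (fun_mult f g) = (\<lambda>s\<in>right_half_plane. \<Sum>i=0..l.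
    fun_scale (of_nat (l choose i)) (fun_mult (fun_deriv i f) (fun_deriv (l - i) g)) s)"
proof -
  have "fun_deriv l (fun_mult f g) = fun_deriv l (\<lambda>s. f s * g s)"
    by (rule fun_deriv_cong[symmetric]) (auto simp: fun_mult_def intro!: holomorphic_intros assms)
  also have "\<dots> = (\<lambda>s\<in>right_half_plane. \<Sum>i=0..l.
      fun_scale (of_nat (l choose i)) (fun_mult (fun_deriv i f) (fun_deriv (l - i) g)) s)"
    unfolding fun_deriv_def fun_mult_def fun_scale_def
    by (rule restrict_ext) (simp add: higher_deriv_mult[OF assms open_half_plane] mult.assoc)
  finally show ?thesis .
qed

lemma fun_deriv_zero: "fun_deriv l (fun_const 0) = fun_const 0"
proof -
  have "fun_deriv l (fun_const 0) = fun_deriv l (\<lambda>s. 0)"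
    by (rule fun_deriv_cong[symmetric]) (auto simp: fun_const_def)
  also have "(deriv ^^ l) (\<lambda>s::complex. 0::complex) = (\<lambda>s. 0)"
    by (induction l) auto
  then have "fun_deriv l (\<lambda>s. 0) = fun_const 0" by (simp add: fun_deriv_def fun_const_def)
  finally show ?thesis .
qed

context banach_function_algebra
begin

lemma sum_closed:
  assumes "finite I" "\<And>i. i \<in> I \<Longrightarrow> h i \<in> B"
  shows "(\<lambda>s\<in>right_half_plane. \<Sum>i\<in>I. h i s) \<in> B"
  using assms
proof (induction I)
  case empty
  then show ?case using zero_closed unfolding fun_const_def by (simp only: sum.empty)
next
  case (insert i I)
  have eq: "(\<lambda>s\<in>right_half_plane. \<Sum>i\<in>insert i I. h i s) =
      fun_add (h i) (\<lambda>s\<in>right_half_plane. \<Sum>i\<in>I. h i s)"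
    unfolding fun_add_def using insert.hyps by (intro restrict_ext) simp
  show ?case unfolding eq by (intro add_closed insert.IH insert.prems) auto
qed

text \<open>Adds order 0, which the carrier condition does not list; there extensionality makes
  \<open>fun_deriv 0 f\<close> equal to \<open>f\<close>. The Leibniz rule needs all orders
  alike.\<close>

lemma fun_deriv_closed:
  assumes f: "f \<in> carrier (deriv_algebra m B)" and "l \<le> m"
  shows "fun_deriv l f \<in> B"
proof (cases l)
  case 0
  then have "fun_deriv l f = f"
    using f subset_extensional by (auto simp: fun_deriv_def deriv_algebra_def extensional_restrict)
  then show ?thesis using f by (simp add: deriv_algebra_def)
next
  case (Suc k)
  then show ?thesis using assms by (simp add: deriv_algebra_def)
qed

lemma deriv_algebra_add_closed:
  assumes "B \<subseteq> H_infinity" "f \<in> carrier (deriv_algebra m B)" "g \<in> carrier (deriv_algebra m B)"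
  shows "fun_add f g \<in> carrier (deriv_algebra m B)"
proof -
  have "f holomorphic_on right_half_plane" "g holomorphic_on right_half_plane"
    using assms by (auto simp: deriv_algebra_def intro!: H_infinity_holomorphic)
  then show ?thesis
    using assms(2,3) by (simp add: deriv_algebra_def fun_deriv_add add_closed)
qed

lemma deriv_algebra_mult_closed:
  assumes B: "B \<subseteq> H_infinity" and f: "f \<in> carrier (deriv_algebra m B)"
    and g: "g \<in> carrier (deriv_algebra m B)"
  shows "fun_mult f g \<in> carrier (deriv_algebra m B)"
proof -
  have "f holomorphic_on right_half_plane" "g holomorphic_on right_half_plane"
    using assms by (auto simp: deriv_algebra_def intro!: H_infinity_holomorphic)
  then have "fun_deriv l (fun_mult f g) \<in> B" if "l \<le> m" for l
    unfolding fun_deriv_mult[OF \<open>f holomorphic_on _\<close> \<open>g holomorphic_on _\<close>]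
    using that by (intro sum_closed scale_closed mult_closed fun_deriv_closed[of _ m] f g) auto
  moreover have "fun_mult f g \<in> B"
    using f g by (simp add: deriv_algebra_def mult_closed)
  ultimately show ?thesis by (simp add: deriv_algebra_def)
qed

text \<open>This is the structure in which \<open>finsum\<close>, and with it unimodularity, can be
  unfolded.\<close>

lemma abelian_monoid_deriv_algebra:
  assumes "B \<subseteq> H_infinity"
  shows "abelian_monoid (deriv_algebra m B)"
proof (rule abelian_monoidI)
  show "x \<oplus>\<^bsub>deriv_algebra m B\<^esub> y \<in> carrier (deriv_algebra m B)"
    if "x \<in> carrier (deriv_algebra m B)" "y \<in> carrier (deriv_algebra m B)" for x y
    using deriv_algebra_add_closed[OF assms that] by (simp add: deriv_algebra_def)
  show "\<zero>\<^bsub>deriv_algebra m B\<^esub> \<in> carrier (deriv_algebra m B)"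
    by (simp add: deriv_algebra_def fun_deriv_zero zero_closed)
  show "\<zero>\<^bsub>deriv_algebra m B\<^esub> \<oplus>\<^bsub>deriv_algebra m B\<^esub> x = x"
    if "x \<in> carrier (deriv_algebra m B)" for x
  proof -
    have "x \<in> extensional right_half_plane"
      using that subset_extensional by (auto simp: deriv_algebra_def)
    then show ?thesis
      by (auto simp: deriv_algebra_def fun_add_def fun_const_def extensional_def restrict_def)
  qed
qed (auto simp: deriv_algebra_def fun_add_def restrict_def add_ac)

end

section \<open>Finite sums in the ring\<close>

lemma dirichlet_eval_finsum:
  assumes "abelian_monoid R" and add: "(\<oplus>\<^bsub>R\<^esub>) = fun_add" and zero: "\<zero>\<^bsub>R\<^esub> = fun_const 0"
    and sub: "carrier R \<subseteq> H_infinity" and chi: "small_character chi"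
    and "finite I" and "h \<in> I \<rightarrow> carrier R"
  shows "dirichlet_eval chi (\<Oplus>\<^bsub>R\<^esub>i\<in>I. h i) = (\<Sum>i\<in>I. dirichlet_eval chi (h i))"
proof -
  interpret abelian_monoid R by fact
  have dc: "\<exists>a. dirichlet_coeffs f a" if "f \<in> carrier R" for f
    using that sub dirichlet_coeffs_of_H_infinity by blast
  show ?thesis
    using \<open>finite I\<close> \<open>h \<in> I \<rightarrow> carrier R\<close>
  proof (induction I)
    case empty
    obtain a where a: "dirichlet_coeffs (fun_const 0) a"
      using dc[OF zero_closed] zero by auto
    \<comment> \<open>Additivity applied to 0 + 0 = 0 forces the value 0.\<close>
    have "fun_add (fun_const 0) (fun_const 0) = fun_const 0"
      by (simp add: fun_add_def fun_const_def restrict_def fun_eq_iff)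
    then have "dirichlet_eval chi (fun_const 0) = 0"
      using dirichlet_eval_add[OF a a chi] by simp
    then show ?case by (simp add: zero)
  next
    case (insert i I)
    then have i: "h i \<in> carrier R" and I: "h \<in> I \<rightarrow> carrier R" by auto
    have S: "(\<Oplus>\<^bsub>R\<^esub>i\<in>I. h i) \<in> carrier R" by (rule finsum_closed[OF I])
    obtain a b where "dirichlet_coeffs (h i) a" "dirichlet_coeffs (\<Oplus>\<^bsub>R\<^esub>i\<in>I. h i) b"
      using dc[OF i] dc[OF S] by blast
    then show ?case
      using insert i I by (simp add: finsum_insert add dirichlet_eval_add[OF _ _ chi])
  qed
qed

lemma finsum_pointwise:
  assumes "abelian_monoid R" and add: "(\<oplus>\<^bsub>R\<^esub>) = fun_add" and zero: "\<zero>\<^bsub>R\<^esub> = fun_const 0"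
    and "finite I" and "h \<in> I \<rightarrow> carrier R"
  shows "(\<Oplus>\<^bsub>R\<^esub>i\<in>I. h i) = (\<lambda>s\<in>right_half_plane. \<Sum>i\<in>I. h i s)"
proof -
  interpret abelian_monoid R by fact
  show ?thesis
    using \<open>finite I\<close> \<open>h \<in> I \<rightarrow> carrier R\<close>
  proof (induction I)
    case empty
    then show ?case unfolding finsum_empty zero fun_const_def by (simp only: sum.empty)
  next
    case (insert i I)
    then have i: "h i \<in> carrier R" and I: "h \<in> I \<rightarrow> carrier R" by auto
    have "(\<Oplus>\<^bsub>R\<^esub>i\<in>insert i I. h i) = fun_add (h i) (\<lambda>s\<in>right_half_plane. \<Sum>i\<in>I. h i s)"
      unfolding finsum_insert[OF insert.hyps I i] insert.IH[OF I] add ..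
    also have "\<dots> = (\<lambda>s\<in>right_half_plane. \<Sum>i\<in>insert i I. h i s)"
      unfolding fun_add_def using insert.hyps by (intro restrict_ext) simp
    finally show ?case .
  qed
qed

section \<open>Dirichlet polynomials with an arbitrary index set\<close>

definition dpoly :: "'i set \<Rightarrow> ('i \<Rightarrow> complex) \<Rightarrow> ('i \<Rightarrow> nat) \<Rightarrow> complex \<Rightarrow> complex" where
  "dpoly I c k = (\<lambda>s\<in>right_half_plane. \<Sum>i\<in>I. c i / of_nat (k i) powr s)"

text \<open>Frequencies may repeat and come in any order; the coefficient of n collects all indices
  with \<open>k i = n\<close>. Inserting 1 under the maximum keeps \<open>N\<close> positive when
  \<open>I\<close> is empty.\<close>

lemma dpoly_in_dirichlet_polynomials:
  assumes "finite I" and "\<And>i. i \<in> I \<Longrightarrow> k i \<ge> 1"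
  shows "dpoly I c k \<in> dirichlet_polynomials"
proof -
  define N where "N = Max (insert 1 (k ` I))"
  have N: "N \<ge> 1" "k ` I \<subseteq> {1..N}"
    using assms by (auto simp: N_def)
  have "(\<Sum>i\<in>I. c i / of_nat (k i) powr s) =
      (\<Sum>n=1..N. (\<Sum>i | i \<in> I \<and> k i = n. c i) / of_nat n powr s)" for s
  proof -
    have "(\<Sum>i\<in>I. c i / of_nat (k i) powr s) =
        (\<Sum>n=1..N. \<Sum>i | i \<in> I \<and> k i = n. c i / of_nat (k i) powr s)"
      using assms(1) N by (intro sum.group[symmetric]) auto
    also have "\<dots> = (\<Sum>n=1..N. (\<Sum>i | i \<in> I \<and> k i = n. c i) / of_nat n powr s)"
      by (intro sum.cong refl) (simp add: sum_divide_distrib)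
    finally show ?thesis .
  qed
  then have "dpoly I c k = (\<lambda>s\<in>right_half_plane.
      \<Sum>n=1..N. (\<Sum>i | i \<in> I \<and> k i = n. c i) / of_nat n powr s)"
    unfolding dpoly_def by (intro restrict_ext)
  then show ?thesis
    unfolding dirichlet_polynomials_def using N(1)
    by (intro CollectI exI[of _ "\<lambda>n. \<Sum>i | i \<in> I \<and> k i = n. c i"] exI[of _ N]) simp
qed

lemma higher_deriv_dirichlet_sum:
  assumes "\<And>i. i \<in> I \<Longrightarrow> k i \<ge> 1"
  shows "(deriv ^^ l) (\<lambda>s. \<Sum>i\<in>I. c i / of_nat (k i) powr s) =
    (\<lambda>s. \<Sum>i\<in>I. c i * (- Ln (of_nat (k i))) ^ l / of_nat (k i) powr s)"
proof (induction l)
  case (Suc l)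
  have "deriv (\<lambda>s. \<Sum>i\<in>I. c i * (- Ln (of_nat (k i))) ^ l / of_nat (k i) powr s) s =
      (\<Sum>i\<in>I. c i * (- Ln (of_nat (k i))) ^ Suc l / of_nat (k i) powr s)" for s
  proof (rule DERIV_imp_deriv, rule DERIV_sum)
    fix i assume "i \<in> I"
    then have "k i \<noteq> 0" using assms[of i] by auto
    have "((\<lambda>s. c i * (- Ln (of_nat (k i))) ^ l * exp (- (s * Ln (of_nat (k i)))))
      has_field_derivative
        c i * (- Ln (of_nat (k i))) ^ l * (exp (- (s * Ln (of_nat (k i)))) * - Ln (of_nat (k i)))) (at s)"
      by (auto intro!: derivative_eq_intros)
    then show "((\<lambda>s. c i * (- Ln (of_nat (k i))) ^ l / of_nat (k i) powr s) has_field_derivative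
        c i * (- Ln (of_nat (k i))) ^ Suc l / of_nat (k i) powr s) (at s)"
      using \<open>k i \<noteq> 0\<close> by (simp add: powr_def exp_minus divide_inverse mult_ac)
  qed
  then show ?case by (simp add: Suc fun_eq_iff)
qed simp

lemma fun_deriv_dpoly:
  assumes "\<And>i. i \<in> I \<Longrightarrow> k i \<ge> 1"
  shows "fun_deriv l (dpoly I c k) = dpoly I (\<lambda>i. c i * (- Ln (of_nat (k i))) ^ l) k"
proof -
  have "fun_deriv l (dpoly I c k) = fun_deriv l (\<lambda>s. \<Sum>i\<in>I. c i / of_nat (k i) powr s)"
    using assms
    by (intro fun_deriv_cong[symmetric] holomorphic_intros) (force simp: dpoly_def)+
  also have "\<dots> = dpoly I (\<lambda>i. c i * (- Ln (of_nat (k i))) ^ l) k"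
    unfolding fun_deriv_def dpoly_def
    by (rule restrict_ext) (simp only: higher_deriv_dirichlet_sum[OF assms])
  finally show ?thesis .
qed

text \<open>Differentiation multiplies each coefficient by \<open>- Ln (k i)\<close> and keeps the
  frequencies, so every derivative is again a Dirichlet polynomial and lies in
  \<open>B\<close>.\<close>

lemma dpoly_in_carrier:
  assumes "dirichlet_polynomials \<subseteq> B" and "finite I" and "\<And>i. i \<in> I \<Longrightarrow> k i \<ge> 1"
  shows "dpoly I c k \<in> carrier (deriv_algebra m B)"
  using dpoly_in_dirichlet_polynomials[OF assms(2,3)] assms
  by (auto simp: deriv_algebra_def fun_deriv_dpoly)

lemma coeff_single:
  assumes "j \<ge> 1"
  shows "coeff_summable (\<lambda>n. if n = j then z else 0)"
    and "coeff_sum (\<lambda>n. if n = j then z else 0) chi = z * chi j"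
proof -
  have "((\<lambda>n. norm ((if n = j then z else 0) / of_nat n ^ 2)) has_sum norm (z / of_nat j ^ 2)) {1..}"
    using assms by (intro has_sum_finite_neutralI[of "{j}"]) auto
  then show "coeff_summable (\<lambda>n. if n = j then z else 0)"
    unfolding coeff_summable_def summable_on_def by blast
  have "((\<lambda>n. (if n = j then z else 0) * chi n) has_sum z * chi j) {1..}"
    using assms by (intro has_sum_finite_neutralI[of "{j}"]) auto
  then show "coeff_sum (\<lambda>n. if n = j then z else 0) chi = z * chi j"
    unfolding coeff_sum_def by (rule infsumI)
qed

lemma coeff_finite_support:
  assumes "finite I" and "\<And>i. i \<in> I \<Longrightarrow> k i \<ge> 1"
    and chi: "\<And>n. n > 0 \<Longrightarrow> cmod (chi n) \<le> 1 / (real n)\<^sup>2"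
  shows "coeff_summable (\<lambda>n. \<Sum>i\<in>I. if n = k i then c i else 0) \<and>
    coeff_sum (\<lambda>n. \<Sum>i\<in>I. if n = k i then c i else 0) chi = (\<Sum>i\<in>I. c i * chi (k i))"
  using assms(1,2)
proof (induction I)
  case empty
  then show ?case by (simp add: coeff_summable_def coeff_sum_def)
next
  case (insert j I)
  then have j: "k j \<ge> 1"
    and IH: "coeff_summable (\<lambda>n. \<Sum>i\<in>I. if n = k i then c i else 0)"
      "coeff_sum (\<lambda>n. \<Sum>i\<in>I. if n = k i then c i else 0) chi = (\<Sum>i\<in>I. c i * chi (k i))"
    by auto
  show ?case
    unfolding sum.insert[OF insert.hyps]
    using coeff_summable_add[OF coeff_single(1)[OF j] IH(1)]
      coeff_sum_add[OF coeff_single(1)[OF j] IH(1) chi] coeff_single(2)[OF j] IH(2) by auto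
qed

lemma dirichlet_coeffs_dpoly:
  assumes "finite I" and "\<And>i. i \<in> I \<Longrightarrow> k i \<ge> 1"
  shows "dirichlet_coeffs (dpoly I c k) (\<lambda>n. \<Sum>i\<in>I. if n = k i then c i else 0)"
  unfolding dirichlet_coeffs_def
proof (intro conjI allI impI)
  show "coeff_summable (\<lambda>n. \<Sum>i\<in>I. if n = k i then c i else 0)"
    using coeff_finite_support[OF assms power_le_inverse_square[of 2]] by auto
  fix j :: nat assume j: "j \<ge> 2"
  have "of_nat (k i) powr of_nat j = (of_nat (k i) :: complex) ^ j" if "i \<in> I" for i
    using j by (simp add: powr_nat')
  then show "dpoly I c k (of_nat j) =
      coeff_sum (\<lambda>n. \<Sum>i\<in>I. if n = k i then c i else 0) (\<lambda>n. 1 / of_nat n ^ j)"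
    using coeff_finite_support[OF assms power_le_inverse_square[OF j]] of_nat_in_half_plane[OF j]
    by (simp add: dpoly_def)
qed

lemma dirichlet_eval_dpoly:
  assumes "small_character chi" "finite I" and "\<And>i. i \<in> I \<Longrightarrow> k i \<ge> 1"
  shows "dirichlet_eval chi (dpoly I c k) = (\<Sum>i\<in>I. c i * chi (k i))"
  using coeff_finite_support[OF assms(2,3), where chi = chi] assms(1)
  by (simp add: dirichlet_eval_eq[OF dirichlet_coeffs_dpoly[OF assms(2,3)]] small_character_def)

section \<open>Unimodular tuples that are not reducible\<close>

lemma powr_of_nat_mult: "(of_nat (m * n) :: complex) powr s = of_nat m powr s * of_nat n powr s"
  unfolding of_nat_mult by (rule powr_times_real) auto

lemma continuous_on_to_complex: "continuous_on S (\<lambda>x. to_complex x j)"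
proof -
  have "continuous_on S (\<lambda>x :: nat \<Rightarrow> real. x i)" for i
    by (rule continuous_on_subset[OF continuous_on_product_coordinates]) simp
  then show ?thesis
    unfolding to_complex_def Complex_eq by (intro continuous_intros)
qed

lemma norm_to_complex_le:
  assumes "x \<in> finball (2 * n - 1)" "j < n"
  shows "cmod (to_complex x j) \<le> 1"
proof -
  have "(cmod (to_complex x j))\<^sup>2 \<le> (\<Sum>j<n. (cmod (to_complex x j))\<^sup>2)"
    using assms(2) by (intro member_le_sum) auto
  also have "\<dots> = (\<Sum>i\<le>2 * n - 1. (x i)\<^sup>2)"
    unfolding sum_norm_to_complex using assms(2) by (intro sum.cong) auto
  also have "\<dots> \<le> 1" using assms(1) by (simp add: finball_def)
  finally show ?thesis by (simp add: power_le_one_iff abs_square_le_1)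
qed

lemma obtain_primes:
  obtains e :: "nat \<Rightarrow> nat" where "inj e" "\<And>i. prime (e i)"
  using infinite_countable_subset[OF primes_infinite] by (force simp: image_subset_iff)

text \<open>
  Coordinate \<open>j\<close> of the point of the complex ball is placed at the prime \<open>e (2 * j)\<close> and its conjugate
  at \<open>e (2 * j + 1)\<close>, so that products of the two values are squared moduli.
\<close>

definition prime_values :: "(nat \<Rightarrow> nat) \<Rightarrow> nat \<Rightarrow> real \<Rightarrow> (nat \<Rightarrow> real) \<Rightarrow> nat \<Rightarrow> complex" where
  "prime_values e n r x p =
     (if p \<in> e ` {..<2 * n} then
        of_real r * (let i = inv_into UNIV e p in
          if even i then to_complex x (i div 2) else cnj (to_complex x (i div 2)))
      else 0)"

lemma continuous_on_prime_values: "continuous_on S (\<lambda>x. prime_values e n r x p)"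
  unfolding prime_values_def Let_def
  by (cases "p \<in> e ` {..<2 * n}"; cases "even (inv_into UNIV e p)")
     (simp_all add: continuous_on_to_complex continuous_on_cnj continuous_on_mult_left)

lemma
  assumes "inj e" "j < n"
  shows prime_values_even: "prime_values e n r x (e (2 * j)) = of_real r * to_complex x j"
    and prime_values_odd: "prime_values e n r x (e (Suc (2 * j))) = of_real r * cnj (to_complex x j)"
  using assms by (auto simp: prime_values_def)

lemma small_character_prime_values:
  assumes "inj e" and "x \<in> finball (2 * n - 1)" and "0 \<le> r"
    and r: "\<And>i. i < 2 * n \<Longrightarrow> r \<le> 1 / (real (e i))\<^sup>2"
  shows "small_character (mult_ext (prime_values e n r x))"
proof (rule small_character_mult_ext)
  fix p :: nat
  show "cmod (prime_values e n r x p) \<le> 1 / (real p)\<^sup>2"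
  proof (cases "p \<in> e ` {..<2 * n}")
    case True
    then obtain i where i: "i < 2 * n" "p = e i" by auto
    then have "cmod (to_complex x (i div 2)) \<le> 1"
      by (intro norm_to_complex_le[OF assms(2)]) auto
    then have "cmod (prime_values e n r x p) \<le> r * 1"
      using i assms(1,3) by (auto simp: prime_values_def norm_mult mult_left_le)
    then show ?thesis using r[OF i(1)] i by simp
  qed (auto simp: prime_values_def)
qed

lemma exists_unimodular_not_reducible:
  assumes "banach_function_algebra B N" and P: "dirichlet_polynomials \<subseteq> B"
    and B: "B \<subseteq> H_infinity" and n: "n \<ge> 1"
  shows "\<exists>a \<in> unimodular (deriv_algebra m B) (n + 1). \<not> reducible (deriv_algebra m B) n a"
proof -
  interpret banach_function_algebra B N by fact
  define R where "R = deriv_algebra m B"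
  have R_mult: "(\<otimes>\<^bsub>R\<^esub>) = fun_mult" and R_one: "\<one>\<^bsub>R\<^esub> = fun_const 1"
    and R_add: "(\<oplus>\<^bsub>R\<^esub>) = fun_add" and R_zero: "\<zero>\<^bsub>R\<^esub> = fun_const 0"
    by (simp_all add: R_def deriv_algebra_def)
  have R_am: "abelian_monoid R" unfolding R_def by (rule abelian_monoid_deriv_algebra[OF B])
  have R_sub: "carrier R \<subseteq> H_infinity" using B by (auto simp: R_def deriv_algebra_def)
  have R_mult_closed: "fun_mult f g \<in> carrier R" if "f \<in> carrier R" "g \<in> carrier R" for f g
    using deriv_algebra_mult_closed[OF B] that unfolding R_def by blast
  have R_add_closed: "fun_add f g \<in> carrier R" if "f \<in> carrier R" "g \<in> carrier R" for f g
    using deriv_algebra_add_closed[OF B] that unfolding R_def by blast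
  have R_dpoly: "dpoly I c k \<in> carrier R" if "finite I" "\<And>i. i \<in> I \<Longrightarrow> k i \<ge> 1" for I :: "nat set" and c k
    unfolding R_def by (rule dpoly_in_carrier[OF P that])
  have R_coeffs: "\<exists>a. dirichlet_coeffs f a" if "f \<in> carrier R" for f
    using that R_sub dirichlet_coeffs_of_H_infinity by blast

  obtain e :: "nat \<Rightarrow> nat" where e: "inj e" "\<And>i. prime (e i)" by (rule obtain_primes) blast
  have e_pos: "e i \<ge> 1" for i using prime_ge_1_nat[OF e(2)] by simp
  \<comment> \<open>Any common upper bound of the chosen primes would serve; with
    \<open>r = 1 / M^2\<close> the values at these primes obey the bound p^-2.\<close>
  define M where "M = (\<Sum>i<2 * n. e i)"
  define r where "r = 1 / (real M)\<^sup>2"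
  have M: "e i \<le> M" if "i < 2 * n" for i
    unfolding M_def using that by (intro member_le_sum) auto
  have "M \<ge> 1" using M[of 0] e_pos[of 0] n by linarith
  have r: "r > 0" "r \<le> 1 / (real (e i))\<^sup>2" if "i < 2 * n" for i
    using M[OF that] \<open>M \<ge> 1\<close> e_pos[of i] unfolding r_def
    by (auto intro!: divide_left_mono power_mono mult_pos_pos)
  have "r > 0" using r(1)[of 0] n by simp
  define chi where "chi x = mult_ext (prime_values e n r x)" for x
  have chi: "small_character (chi x)" if "x \<in> finball (2 * n - 1)" for x
    unfolding chi_def using small_character_prime_values[OF e(1) that] r \<open>r > 0\<close> by simp
  have chi_even: "chi x (e (2 * j)) = of_real r * to_complex x j"
    and chi_odd: "chi x (e (Suc (2 * j))) = of_real r * cnj (to_complex x j)" if "j < n" for x j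
    unfolding chi_def using that e by (simp_all add: mult_ext_prime prime_values_even prime_values_odd)

  \<comment> \<open>The character sends \<open>z i\<close> to \<open>r\<close> times a coordinate of the ball, and \<open>d\<close> to one minus the squared norm.\<close>
  define z where "z i = dpoly {0::nat} (\<lambda>_. 1) (\<lambda>_. e (2 * (i - 1)))" for i :: nat
  define z' where "z' i = dpoly {0::nat} (\<lambda>_. of_real (1 / r\<^sup>2)) (\<lambda>_. e (Suc (2 * (i - 1))))" for i :: nat
  define d where "d = dpoly {..n} (\<lambda>j. if j = 0 then 1 else - of_real (1 / r\<^sup>2))
      (\<lambda>j. if j = 0 then 1 else e (2 * (j - 1)) * e (Suc (2 * (j - 1))))"
  have one: "fun_const 1 = dpoly {0::nat} (\<lambda>_. 1) (\<lambda>_. 1)"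
    unfolding fun_const_def dpoly_def by (rule restrict_ext) simp
  have closed: "z i \<in> carrier R" "z' i \<in> carrier R" "d \<in> carrier R" "fun_const 1 \<in> carrier R" for i
    unfolding z_def z'_def d_def one by (intro R_dpoly; use e_pos in \<open>simp add: Suc_le_eq\<close>)+
  have split: "(\<Sum>j\<le>n. g j) = g 0 + (\<Sum>j=1..n. g j)" for g :: "nat \<Rightarrow> complex"
    by (simp add: atMost_atLeast0 sum.atLeast_Suc_atMost)
  have eval_z: "dirichlet_eval (chi x) (z i) = of_real r * to_complex x (i - 1)"
    if "x \<in> finball (2 * n - 1)" "i \<in> {1..n}" for x i
    using that e_pos unfolding z_def by (subst dirichlet_eval_dpoly[OF chi]) (auto simp: chi_even Suc_le_eq)
  have eval_d: "dirichlet_eval (chi x) d = 1 - of_real (\<Sum>j<n. (cmod (to_complex x j))\<^sup>2)"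
    if x: "x \<in> finball (2 * n - 1)" for x
  proof -
    have "dirichlet_eval (chi x) d = (\<Sum>j\<le>n. (if j = 0 then 1 else - of_real (1 / r\<^sup>2)) *
        chi x (if j = 0 then 1 else e (2 * (j - 1)) * e (Suc (2 * (j - 1)))))"
      unfolding d_def using e_pos by (intro dirichlet_eval_dpoly[OF chi[OF x]]) (auto simp: Suc_le_eq)
    also have "\<dots> = chi x 1 + (\<Sum>j=1..n. - of_real (1 / r\<^sup>2) *
        chi x (e (2 * (j - 1)) * e (Suc (2 * (j - 1)))))"
      unfolding split by (intro arg_cong2[where f = "(+)"] sum.cong) auto
    also have "chi x 1 = 1" using chi[OF x] by (simp add: small_character_def)
    also have "(\<Sum>j=1..n. - of_real (1 / r\<^sup>2) * chi x (e (2 * (j - 1)) * e (Suc (2 * (j - 1))))) =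
        (\<Sum>j<n. - of_real (1 / r\<^sup>2) * chi x (e (2 * j) * e (Suc (2 * j))))"
      by (rule sum.reindex_bij_witness[of _ Suc "\<lambda>j. j - 1"]) auto
    also have "\<dots> = (\<Sum>j<n. - of_real ((cmod (to_complex x j))\<^sup>2))"
    proof (rule sum.cong[OF refl])
      fix j assume "j \<in> {..<n}"
      \<comment> \<open>The two primes contribute r^2 times a coordinate times its conjugate, which
        cancels the factor r^-2.\<close>
      have "chi x (e (2 * j) * e (Suc (2 * j))) = chi x (e (2 * j)) * chi x (e (Suc (2 * j)))"
        using chi[OF x] e_pos by (simp add: small_character_def Suc_le_eq)
      also have "\<dots> = of_real (r\<^sup>2) * (to_complex x j * cnj (to_complex x j))"
        using \<open>j \<in> {..<n}\<close> by (simp add: chi_even chi_odd power2_eq_square)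
      also have "to_complex x j * cnj (to_complex x j) = of_real ((cmod (to_complex x j))\<^sup>2)"
        by (rule complex_norm_square[symmetric])
      finally show "- of_real (1 / r\<^sup>2) * chi x (e (2 * j) * e (Suc (2 * j))) =
          - of_real ((cmod (to_complex x j))\<^sup>2)"
        using \<open>r > 0\<close> by simp
    qed
    finally show ?thesis by (simp add: sum_negf)
  qed

  define a where "a = (\<lambda>i\<in>{1..n + 1}. if i = n + 1 then d else z i)"
  define b where "b = (\<lambda>i\<in>{1..n + 1}. if i = n + 1 then fun_const 1 else z' i)"
  have ab_in: "a \<in> {1..n + 1} \<rightarrow>\<^sub>E carrier R" "b \<in> {1..n + 1} \<rightarrow>\<^sub>E carrier R"
    unfolding a_def b_def using closed by auto
  have "(\<Oplus>\<^bsub>R\<^esub>i\<in>{1..n + 1}. fun_mult (b i) (a i)) =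
      (\<lambda>s\<in>right_half_plane. \<Sum>i\<in>{1..n + 1}. fun_mult (b i) (a i) s)"
    using ab_in by (intro finsum_pointwise[OF R_am R_add R_zero]) (auto intro!: R_mult_closed)
  also have "\<dots> = fun_const 1"
    unfolding fun_const_def
  proof (rule restrict_ext)
    fix s assume s: "s \<in> right_half_plane"
    have d_s: "d s = 1 + (\<Sum>i=1..n. - of_real (1 / r\<^sup>2) /
        of_nat (e (2 * (i - 1)) * e (Suc (2 * (i - 1)))) powr s)"
      using s unfolding d_def dpoly_def split restrict_apply'[OF s]
      by (intro arg_cong2[where f = "(+)"] sum.cong) auto
    have "(\<Sum>i\<in>{1..n + 1}. fun_mult (b i) (a i) s) =
        (\<Sum>i=1..n. fun_mult (b i) (a i) s) + fun_mult (b (n + 1)) (a (n + 1)) s"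
      by simp
    also have "fun_mult (b (n + 1)) (a (n + 1)) s = d s"
      using s by (simp add: fun_mult_def a_def b_def fun_const_def)
    also have "(\<Sum>i=1..n. fun_mult (b i) (a i) s) = (\<Sum>i=1..n. of_real (1 / r\<^sup>2) /
        of_nat (e (2 * (i - 1)) * e (Suc (2 * (i - 1)))) powr s)"
    proof (rule sum.cong[OF refl])
      fix i assume i: "i \<in> {1..n}"
      then have "fun_mult (b i) (a i) s = z' i s * z i s"
        using s by (simp add: fun_mult_def a_def b_def)
      also have "\<dots> = of_real (1 / r\<^sup>2) / of_nat (e (2 * (i - 1)) * e (Suc (2 * (i - 1)))) powr s"
        unfolding powr_of_nat_mult using s by (simp add: z_def z'_def dpoly_def)
      finally show "fun_mult (b i) (a i) s =
        of_real (1 / r\<^sup>2) / of_nat (e (2 * (i - 1)) * e (Suc (2 * (i - 1)))) powr s" .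
    qed
    finally show "(\<Sum>i\<in>{1..n + 1}. fun_mult (b i) (a i) s) = 1"
      unfolding d_s by (simp add: sum_negf)
  qed
  finally have "a \<in> unimodular R (n + 1)"
    unfolding unimodular_def R_mult R_one using ab_in by blast
  moreover have "\<not> reducible R n a"
  proof
    assume "reducible R n a"
    then obtain x where x: "x \<in> {1..n} \<rightarrow>\<^sub>E carrier R"
      and "(\<lambda>i\<in>{1..n}. fun_add (a i) (fun_mult (x i) (a (n + 1)))) \<in> unimodular R n"
      unfolding reducible_def R_mult R_add by blast
    then obtain y where y: "y \<in> {1..n} \<rightarrow>\<^sub>E carrier R"
      and y_sum: "(\<Oplus>\<^bsub>R\<^esub>i\<in>{1..n}. fun_mult (y i)
        ((\<lambda>i\<in>{1..n}. fun_add (a i) (fun_mult (x i) (a (n + 1)))) i)) = fun_const 1"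
      unfolding unimodular_def R_mult R_one by blast
    define w where "w i = fun_add (z i) (fun_mult (x i) d)" for i
    have w: "w i \<in> carrier R" if "i \<in> {1..n}" for i
      unfolding w_def using x that closed by (intro R_add_closed R_mult_closed) auto
    have "(\<Oplus>\<^bsub>R\<^esub>i\<in>{1..n}. fun_mult (y i) (w i)) = fun_const 1"
    proof -
      interpret abelian_monoid R by (rule R_am)
      have "(\<Oplus>\<^bsub>R\<^esub>i\<in>{1..n}. fun_mult (y i) (w i)) = (\<Oplus>\<^bsub>R\<^esub>i\<in>{1..n}. fun_mult (y i)
        ((\<lambda>i\<in>{1..n}. fun_add (a i) (fun_mult (x i) (a (n + 1)))) i))"
        using y w by (intro finsum_cong') (auto simp: w_def a_def intro!: R_mult_closed)
      then show ?thesis using y_sum by simp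
    qed
    note w_sum = this
    have eval_w: "dirichlet_eval (chi t) (w i) = of_real r * to_complex t (i - 1) + dirichlet_eval (chi t) (x i) *
        (1 - of_real (\<Sum>j<n. (cmod (to_complex t j))\<^sup>2))"
      if t: "t \<in> finball (2 * n - 1)" and i: "i \<in> {1..n}" for t i
    proof -
      have xi: "x i \<in> carrier R" using x i by auto
      have "dirichlet_eval (chi t) (w i) = dirichlet_eval (chi t) (z i) + dirichlet_eval (chi t) (x i) * dirichlet_eval (chi t) d"
        unfolding w_def
        using R_coeffs[OF closed(1)[of i]] R_coeffs[OF xi] R_coeffs[OF closed(3)]
          R_coeffs[OF R_mult_closed[OF xi closed(3)]] dirichlet_eval_add[OF _ _ chi[OF t]] dirichlet_eval_mult[OF _ _ chi[OF t]]
        by metis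
      then show ?thesis using eval_z[OF t i] eval_d[OF t] by simp
    qed
    \<comment> \<open>The shift by \<open>Suc\<close> reconciles tuples indexed from 1 with ball
      coordinates indexed from 0. On the sphere \<open>d\<close> evaluates to 0, so the unknown
      \<open>x\<close> drops out of \<open>F\<close>.\<close>
    define F where "F j t = dirichlet_eval (chi t) (w (Suc j))" for j t
    have "\<exists>t\<in>finball (2 * n - 1). \<forall>j<n. F j t = 0"
    proof (rule finball_complex_map_has_zero[OF n])
      show "r \<noteq> 0" using \<open>r > 0\<close> by simp
      fix j assume j: "j < n"
      then obtain c where "dirichlet_coeffs (w (Suc j)) c"
        using R_coeffs[OF w[of "Suc j"]] by auto
      then show "continuous_on (finball (2 * n - 1)) (F j)"
        unfolding F_def
        by (rule continuous_on_dirichlet_eval)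
           (use chi in \<open>auto simp: chi_def intro!: continuous_on_mult_ext continuous_on_prime_values\<close>)
    next
      fix t j assume "t \<in> finball (2 * n - 1)" "(\<Sum>k<n. (cmod (to_complex t k))\<^sup>2) = 1" "j < n"
      then show "F j t = of_real r * to_complex t j"
        unfolding F_def by (subst eval_w) auto
    qed
    then obtain t where t: "t \<in> finball (2 * n - 1)" and zero: "\<And>j. j < n \<Longrightarrow> F j t = 0"
      by blast
    \<comment> \<open>At the common zero \<open>t\<close> the character sends every
      \<open>w i\<close> to 0, so applying it to the identity expressing 1 through the
      \<open>w i\<close> gives 1 = 0.\<close>
    have "dirichlet_eval (chi t) (fun_const 1) = (\<Sum>i=1..n. dirichlet_eval (chi t) (fun_mult (y i) (w i)))"
      unfolding w_sum[symmetric]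
      using y w by (intro dirichlet_eval_finsum[OF R_am R_add R_zero R_sub chi[OF t]]) (auto intro!: R_mult_closed)
    also have "\<dots> = (\<Sum>i=1..n. 0)"
    proof (rule sum.cong[OF refl])
      fix i assume i: "i \<in> {1..n}"
      then have yi: "y i \<in> carrier R" using y by auto
      have "i - 1 < n" "Suc (i - 1) = i" using i by auto
      then have "dirichlet_eval (chi t) (w i) = 0" using zero[of "i - 1"] by (simp add: F_def)
      then show "dirichlet_eval (chi t) (fun_mult (y i) (w i)) = 0"
        using R_coeffs[OF yi] R_coeffs[OF w[OF i]] dirichlet_eval_mult[OF _ _ chi[OF t]] by fastforce
    qed
    also have "dirichlet_eval (chi t) (fun_const 1) = 1"
      unfolding one using chi[OF t] by (subst dirichlet_eval_dpoly) (auto simp: small_character_def)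
    finally show False by simp
  qed
  ultimately show ?thesis unfolding R_def by blast
qed

theorem corollary3p4:
  fixes m :: nat
    and B :: "(complex \<Rightarrow> complex) set"
    and N :: "(complex \<Rightarrow> complex) \<Rightarrow> real"
  assumes "m \<ge> 1"
    and "banach_function_algebra B N"
    and "dirichlet_polynomials \<subseteq> B" and "B \<subseteq> H_infinity"
    and "\<exists>C>0. \<forall>f\<in>B. sup_norm f \<le> C * N f"
    and "wiener_property B"
  shows "bass_stable_rank (deriv_algebra m B) = \<infinity>"
proof -
  have none: "{n. n \<ge> 1 \<and> (\<forall>a \<in> unimodular (deriv_algebra m B) (n + 1).
      reducible (deriv_algebra m B) n a)} = {}"
    using exists_unimodular_not_reducible[OF assms(2-4)] by blast
  show ?thesis
    unfolding bass_stable_rank_def none by (simp add: top_enat_def)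
qed

end
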